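(* Let $F$ be a field of characteristic $\neq 2$ and let $r\ge 0$, $s>0$ be integers. Let $\mathfrak{Z}(\mathfrak{K}_{r,s})$ denote the center of the Lie algebra $\mathfrak{K}_{r,s}$. Then $\mathfrak{Z}(\mathfrak{K}_{r,s})$ is the $F$-span of $\{e_I: e_I\in\mathfrak{Z}(\mathfrak{K}_{r,s})\}$, where $I$ ranges over multi-indices.
   Context: Let $n=r+s$, let $e_1,\dots,e_n$ be the canonical basis of $F^n$, and let $Q$ be the symmetric bilinear form on $F^n$ with $Q(e_i,e_j)=0$ for $i\ne j$, $Q(e_i,e_i)=1$ for $1\le i\le r$, $Q(e_i,e_i)=-1$ for $r+1\le i\le r+s$. $C\ell(r,s)$ is the Clifford algebra over $F$ of $(F^n,Q)$, with sign convention $v\cdot v=-Q(v,v)1$; it is a Lie algebra with $[x,y]=xy-yx$. Let $c$ be the unique algebra anti-automorphism of $C\ell(r,s)$ with $c(v)=-v$ for $v\in F^n$, and let $\mathfrak{G}_{r,s}=\{\varphi\in C\ell(r,s):c(\varphi)=-\varphi\}$. Let $\beta$ be the algebra automorphism of $C\ell(r,s)$ with $\beta(e_i)=e_i$ for $1\le i\le r$ and $\beta(e_{r+j})=-e_{r+j}$ for $1\le j\le s$; it leaves $\mathfrak{G}_{r,s}$ invariant. $\mathfrak{K}_{r,s}$ is the $+1$ eigenspace of $\beta$ restricted to $\mathfrak{G}_{r,s}$, a Lie subalgebra. A multi-index is a tuple $I=(i_1,\dots,i_k)$, $k\ge1$, with $1\le i_1<\dots<i_k\le n$, and $e_I=e_{i_1}\cdots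 e_{i_k}$. *)

theory Defs
  imports "HOL-Algebra.QuotRing" "HOL-Library.Poly_Mapping"
begin

text \<open>Words form the free monoid under concatenation, so that the convolution product of
  \<^typ>\<open>nat list \<Rightarrow>\<^sub>0 'f\<close> is the product of the free associative algebra on letters from \<^typ>\<open>nat\<close>.\<close>

instantiation list :: (type) monoid_add
begin

definition zero_list_def: "0 = ([] :: 'a list)"

definition plus_list_def: "xs + ys = (xs @ ys :: 'a list)"

instance
  by standard (simp_all add: zero_list_def plus_list_def)

end

type_synonym 'f tensor = "nat list \<Rightarrow>\<^sub>0 'f"

type_synonym 'f clifford = "'f tensor set"

text \<open>The tensor algebra of $F^n$, in coordinates: the word $[i_1,\dots,i_k]$ stands for
  $e_{i_1} \otimes \dots \otimes e_{i_k}$.\<close>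

definition tensor_algebra :: "nat \<Rightarrow> 'f::field tensor ring" where
  "tensor_algebra n =
     \<lparr>carrier = {p. \<forall>w\<in>Poly_Mapping.keys p. set w \<subseteq> {1..n}},
      mult = (*), one = 1, zero = 0, add = (+)\<rparr>"

text \<open>A vector of $F^n$ is given by its coordinates \<open>v 1, \<dots>, v n\<close>; the other values of the
  function \<open>v\<close> are irrelevant.\<close>

definition tensor_vec :: "nat \<Rightarrow> (nat \<Rightarrow> 'f::field) \<Rightarrow> 'f tensor" where
  "tensor_vec n v = (\<Sum>i=1..n. Poly_Mapping.single [i] (v i))"

definition tensor_scalar :: "'f::field \<Rightarrow> 'f tensor" where
  "tensor_scalar a = Poly_Mapping.single [] a"

definition Q_form :: "nat \<Rightarrow> nat \<Rightarrow> (nat \<Rightarrow> 'f::field) \<Rightarrow> (nat \<Rightarrow> 'f) \<Rightarrow> 'f" where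
  "Q_form r s v w = (\<Sum>i=1..r. v i * w i) - (\<Sum>i=r+1..r+s. v i * w i)"

definition clifford_ideal :: "nat \<Rightarrow> nat \<Rightarrow> 'f::field tensor set" where
  "clifford_ideal r s = genideal (tensor_algebra (r + s))
     {tensor_vec (r + s) v * tensor_vec (r + s) v + tensor_scalar (Q_form r s v v) | v. True}"

definition clifford_algebra :: "nat \<Rightarrow> nat \<Rightarrow> 'f::field clifford ring" where
  "clifford_algebra r s = tensor_algebra (r + s) Quot clifford_ideal r s"

definition clifford_proj :: "nat \<Rightarrow> nat \<Rightarrow> 'f::field tensor \<Rightarrow> 'f clifford" where
  "clifford_proj r s p = clifford_ideal r s +>\<^bsub>tensor_algebra (r + s)\<^esub> p"

definition clifford_vec :: "nat \<Rightarrow> nat \<Rightarrow> (nat \<Rightarrow> 'f::field) \<Rightarrow> 'f clifford" where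
  "clifford_vec r s v = clifford_proj r s (tensor_vec (r + s) v)"

definition clifford_smult :: "nat \<Rightarrow> nat \<Rightarrow> 'f::field \<Rightarrow> 'f clifford \<Rightarrow> 'f clifford" where
  "clifford_smult r s a x = clifford_proj r s (tensor_scalar a) \<otimes>\<^bsub>clifford_algebra r s\<^esub> x"

definition clifford_gen :: "nat \<Rightarrow> nat \<Rightarrow> nat \<Rightarrow> 'f::field clifford" where
  "clifford_gen r s i = clifford_vec r s (\<lambda>j. if j = i then 1 else 0)"

definition clifford_linear :: "nat \<Rightarrow> nat \<Rightarrow> ('f::field clifford \<Rightarrow> 'f clifford) \<Rightarrow> bool" where
  "clifford_linear r s f \<longleftrightarrow>
     (\<forall>a. \<forall>x\<in>carrier (clifford_algebra r s).
        f (clifford_smult r s a x) = clifford_smult r s a (f x))"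

definition opposite_ring :: "'a ring \<Rightarrow> 'a ring" where
  "opposite_ring R = R\<lparr>mult := \<lambda>x y. y \<otimes>\<^bsub>R\<^esub> x\<rparr>"

definition clifford_automorphism :: "nat \<Rightarrow> nat \<Rightarrow> ('f::field clifford \<Rightarrow> 'f clifford) \<Rightarrow> bool" where
  "clifford_automorphism r s f \<longleftrightarrow>
     f \<in> ring_iso (clifford_algebra r s) (clifford_algebra r s) \<and> clifford_linear r s f"

definition clifford_antiautomorphism :: "nat \<Rightarrow> nat \<Rightarrow> ('f::field clifford \<Rightarrow> 'f clifford) \<Rightarrow> bool"
  where
  "clifford_antiautomorphism r s f \<longleftrightarrow>
     f \<in> ring_iso (clifford_algebra r s) (opposite_ring (clifford_algebra r s)) \<and>
     clifford_linear r s f"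

text \<open>Extensionality only fixes the irrelevant values outside the carrier; existence and
  uniqueness of \<open>clifford_c\<close> and \<open>clifford_beta\<close> are shown below.\<close>

definition clifford_c :: "nat \<Rightarrow> nat \<Rightarrow> 'f::field clifford \<Rightarrow> 'f clifford" where
  "clifford_c r s = (THE c. c \<in> extensional (carrier (clifford_algebra r s)) \<and>
     clifford_antiautomorphism r s c \<and>
     (\<forall>v. c (clifford_vec r s v) = \<ominus>\<^bsub>clifford_algebra r s\<^esub> clifford_vec r s v))"

definition clifford_beta :: "nat \<Rightarrow> nat \<Rightarrow> 'f::field clifford \<Rightarrow> 'f clifford" where
  "clifford_beta r s = (THE b. b \<in> extensional (carrier (clifford_algebra r s)) \<and>
     clifford_automorphism r s b \<and>
     (\<forall>i\<in>{1..r}. b (clifford_gen r s i) = clifford_gen r s i) \<and>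
     (\<forall>j\<in>{1..s}. b (clifford_gen r s (r + j)) =
        \<ominus>\<^bsub>clifford_algebra r s\<^esub> clifford_gen r s (r + j)))"

definition G_alg :: "nat \<Rightarrow> nat \<Rightarrow> 'f::field clifford set" where
  "G_alg r s = {x \<in> carrier (clifford_algebra r s).
     clifford_c r s x = \<ominus>\<^bsub>clifford_algebra r s\<^esub> x}"

definition K_alg :: "nat \<Rightarrow> nat \<Rightarrow> 'f::field clifford set" where
  "K_alg r s = {x \<in> G_alg r s. clifford_beta r s x = x}"

definition lie_bracket :: "('a, 'b) ring_scheme \<Rightarrow> 'a \<Rightarrow> 'a \<Rightarrow> 'a" where
  "lie_bracket R x y = (x \<otimes>\<^bsub>R\<^esub> y) \<ominus>\<^bsub>R\<^esub> (y \<otimes>\<^bsub>R\<^esub> x)"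

definition lie_center :: "('a, 'b) ring_scheme \<Rightarrow> 'a set \<Rightarrow> 'a set" where
  "lie_center R L = {x \<in> L. \<forall>y\<in>L. lie_bracket R x y = \<zero>\<^bsub>R\<^esub>}"

definition Z_K :: "nat \<Rightarrow> nat \<Rightarrow> 'f::field clifford set" where
  "Z_K r s = lie_center (clifford_algebra r s) (K_alg r s)"

definition multi_index :: "nat \<Rightarrow> nat list \<Rightarrow> bool" where
  "multi_index n I \<longleftrightarrow> I \<noteq> [] \<and> sorted_wrt (<) I \<and> set I \<subseteq> {1..n}"

definition clifford_basis :: "nat \<Rightarrow> nat \<Rightarrow> nat list \<Rightarrow> 'f::field clifford" where
  "clifford_basis r s I = foldr (\<lambda>i x. clifford_gen r s i \<otimes>\<^bsub>clifford_algebra r s\<^esub> x) I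
     \<one>\<^bsub>clifford_algebra r s\<^esub>"

definition clifford_span :: "nat \<Rightarrow> nat \<Rightarrow> 'f::field clifford set \<Rightarrow> 'f clifford set" where
  "clifford_span r s S =
     {finsum (clifford_algebra r s) (\<lambda>x. clifford_smult r s (a x) x) A | a A. finite A \<and> A \<subseteq> S}"


subsection \<open>Existence and uniqueness of \<open>clifford_c\<close> and \<open>clifford_beta\<close>\<close>

lemma tensor_carrier_iff:
  "p \<in> carrier (tensor_algebra n) \<longleftrightarrow> (\<forall>w\<in>Poly_Mapping.keys p. set w \<subseteq> {1..n})"
  by (simp add: tensor_algebra_def)

lemma tensor_algebra_simps [simp]:
  "p \<otimes>\<^bsub>tensor_algebra n\<^esub> q = p * q"
  "p \<oplus>\<^bsub>tensor_algebra n\<^esub> q = p + q"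
  "\<one>\<^bsub>tensor_algebra n\<^esub> = 1"
  "\<zero>\<^bsub>tensor_algebra n\<^esub> = 0"
  by (simp_all add: tensor_algebra_def)

lemma tensor_add_closed:
  assumes "p \<in> carrier (tensor_algebra n)" "q \<in> carrier (tensor_algebra n)"
  shows "p + q \<in> carrier (tensor_algebra n)"
  using assms keys_add[of p q] by (auto simp: tensor_carrier_iff)

lemma tensor_uminus_closed:
  assumes "p \<in> carrier (tensor_algebra n)"
  shows "- p \<in> carrier (tensor_algebra n)"
  using assms by (auto simp: tensor_carrier_iff in_keys_iff)

lemma tensor_mult_closed:
  assumes "p \<in> carrier (tensor_algebra n)" "q \<in> carrier (tensor_algebra n)"
  shows "p * q \<in> carrier (tensor_algebra n)"
  using assms keys_mult[of p q] by (fastforce simp: tensor_carrier_iff plus_list_def)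

lemma tensor_zero_closed: "0 \<in> carrier (tensor_algebra n)"
  by (simp add: tensor_carrier_iff)

lemma tensor_one_closed: "1 \<in> carrier (tensor_algebra n)"
  by (simp add: tensor_carrier_iff zero_list_def)

lemma tensor_ring: "ring (tensor_algebra n)"
proof (rule ringI)
  show "abelian_group (tensor_algebra n)"
  proof (rule abelian_groupI)
    fix p assume "p \<in> carrier (tensor_algebra n)"
    then show "\<exists>q\<in>carrier (tensor_algebra n). q \<oplus>\<^bsub>tensor_algebra n\<^esub> p = \<zero>\<^bsub>tensor_algebra n\<^esub>"
      by (intro bexI[of _ "- p"] tensor_uminus_closed) simp_all
  qed (simp_all add: ac_simps tensor_add_closed tensor_zero_closed)
  show "Group.monoid (tensor_algebra n)"
    by (rule monoidI) (simp_all add: mult.assoc tensor_mult_closed tensor_one_closed)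
qed (simp_all add: algebra_simps)

lemma tensor_minus: "p \<in> carrier (tensor_algebra n) \<Longrightarrow> \<ominus>\<^bsub>tensor_algebra n\<^esub> p = - p"
  by (rule abelian_group.minus_equality[OF ring.is_abelian_group[OF tensor_ring]])
    (simp_all add: tensor_uminus_closed)

lemma tensor_scalar_closed: "tensor_scalar a \<in> carrier (tensor_algebra n)"
  by (auto simp: tensor_carrier_iff tensor_scalar_def)

lemma tensor_vec_closed: "tensor_vec n v \<in> carrier (tensor_algebra n)"
proof -
  have "(\<Sum>i\<in>A. Poly_Mapping.single [i] (v i)) \<in> carrier (tensor_algebra n)"
    if "finite A" "A \<subseteq> {1..n}" for A
    using that
  proof (induction A rule: finite_induct)
    case (insert i A)
    have "Poly_Mapping.single [i] (v i) \<in> carrier (tensor_algebra n)"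
      using insert by (auto simp: tensor_carrier_iff)
    then show ?case using insert by (simp add: tensor_add_closed)
  qed (simp add: tensor_zero_closed)
  then show ?thesis by (simp add: tensor_vec_def)
qed

lemma tensor_relators_closed:
  "{tensor_vec (r + s) v * tensor_vec (r + s) v + tensor_scalar (Q_form r s v v) | v. True}
     \<subseteq> carrier (tensor_algebra (r + s))"
  using tensor_add_closed tensor_mult_closed tensor_vec_closed tensor_scalar_closed by blast

lemma clifford_ideal: "ideal (clifford_ideal r s) (tensor_algebra (r + s))"
  unfolding clifford_ideal_def by (rule ring.genideal_ideal[OF tensor_ring tensor_relators_closed])

lemma clifford_ring: "ring (clifford_algebra r s)"
  unfolding clifford_algebra_def by (rule ideal.quotient_is_ring[OF clifford_ideal])

lemma clifford_proj_hom:
  "clifford_proj r s \<in> ring_hom (tensor_algebra (r + s)) (clifford_algebra r s)"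
  using ideal.rcos_ring_hom[OF clifford_ideal]
  unfolding clifford_algebra_def clifford_proj_def[abs_def] .

lemma clifford_carrier:
  "carrier (clifford_algebra r s) = clifford_proj r s ` carrier (tensor_algebra (r + s))"
  by (auto simp: clifford_algebra_def clifford_proj_def FactRing_def A_RCOSETS_def')

lemma clifford_proj_eq_iff:
  assumes "p \<in> carrier (tensor_algebra (r + s))" "q \<in> carrier (tensor_algebra (r + s))"
  shows "clifford_proj r s p = clifford_proj r s q \<longleftrightarrow> p - q \<in> clifford_ideal r s"
  using ring.quotient_eq_iff_same_a_r_cos[OF tensor_ring clifford_ideal assms] assms
  by (simp add: clifford_proj_def a_minus_def tensor_minus)

lemma clifford_proj_mult:
  assumes "p \<in> carrier (tensor_algebra (r + s))" "q \<in> carrier (tensor_algebra (r + s))"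
  shows "clifford_proj r s p \<otimes>\<^bsub>clifford_algebra r s\<^esub> clifford_proj r s q = clifford_proj r s (p * q)"
  using ring_hom_mult[OF clifford_proj_hom assms] by simp

lemma clifford_proj_add:
  assumes "p \<in> carrier (tensor_algebra (r + s))" "q \<in> carrier (tensor_algebra (r + s))"
  shows "clifford_proj r s p \<oplus>\<^bsub>clifford_algebra r s\<^esub> clifford_proj r s q = clifford_proj r s (p + q)"
  using ring_hom_add[OF clifford_proj_hom assms] by simp

lemma clifford_proj_one: "\<one>\<^bsub>clifford_algebra r s\<^esub> = clifford_proj r s 1"
  by (rule ring_hom_one[OF clifford_proj_hom, symmetric, unfolded tensor_algebra_simps])

lemma clifford_proj_zero: "\<zero>\<^bsub>clifford_algebra r s\<^esub> = clifford_proj r s 0"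
  by (rule ring_hom_zero[OF clifford_proj_hom tensor_ring clifford_ring, symmetric,
        unfolded tensor_algebra_simps])

lemma clifford_proj_uminus:
  assumes p: "p \<in> carrier (tensor_algebra (r + s))"
  shows "\<ominus>\<^bsub>clifford_algebra r s\<^esub> clifford_proj r s p = clifford_proj r s (- p)"
proof -
  interpret ring "clifford_algebra r s" by (rule clifford_ring)
  have m: "- p \<in> carrier (tensor_algebra (r + s))" by (rule tensor_uminus_closed[OF p])
  show ?thesis
    by (rule minus_equality)
      (use clifford_proj_add[OF m p] clifford_carrier[of r s] p m
        in \<open>auto simp: clifford_proj_zero\<close>)
qed

lemma clifford_smult_proj:
  assumes "p \<in> carrier (tensor_algebra (r + s))"
  shows "clifford_smult r s a (clifford_proj r s p) = clifford_proj r s (tensor_scalar a * p)"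
  unfolding clifford_smult_def by (rule clifford_proj_mult[OF tensor_scalar_closed assms])

lemma tensor_induct [consumes 1, case_names zero single add]:
  assumes "p \<in> carrier (tensor_algebra n)"
    and "P 0"
    and "\<And>w a. set w \<subseteq> {1..n} \<Longrightarrow> P (Poly_Mapping.single w a)"
    and "\<And>p q. p \<in> carrier (tensor_algebra n) \<Longrightarrow> q \<in> carrier (tensor_algebra n) \<Longrightarrow>
           P p \<Longrightarrow> P q \<Longrightarrow> P (p + q)"
  shows "P p"
proof -
  have *: "(\<Sum>w\<in>A. Poly_Mapping.single w (Poly_Mapping.lookup p w)) \<in> carrier (tensor_algebra n) \<and>
      P (\<Sum>w\<in>A. Poly_Mapping.single w (Poly_Mapping.lookup p w))"
    if "finite A" "A \<subseteq> Poly_Mapping.keys p" for A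
    using that
  proof (induction A rule: finite_induct)
    case (insert w A)
    have w: "set w \<subseteq> {1..n}" using assms(1) insert by (auto simp: tensor_carrier_iff)
    then have "Poly_Mapping.single w (Poly_Mapping.lookup p w) \<in> carrier (tensor_algebra n)"
      by (auto simp: tensor_carrier_iff)
    then show ?case using insert w assms(3,4) by (simp add: tensor_add_closed)
  qed (use assms(2) in \<open>simp add: tensor_zero_closed\<close>)
  have "p = (\<Sum>w\<in>Poly_Mapping.keys p. Poly_Mapping.single w (Poly_Mapping.lookup p w))"
    by (rule poly_mapping_eqI)
      (auto simp: lookup_sum lookup_single when_def in_keys_iff sum.delta' sum.delta)
  then show ?thesis using *[of "Poly_Mapping.keys p"] by (metis finite_keys order_refl)
qed

text \<open>Signed relabelling of words; instances induce \<open>c\<close> and \<open>\<beta>\<close>.\<close>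

lift_definition tensor_twist ::
  "(nat list \<Rightarrow> nat list) \<Rightarrow> (nat list \<Rightarrow> 'f::field) \<Rightarrow> 'f tensor \<Rightarrow> 'f tensor"
  is "\<lambda>h g p w. if h (h w) = w then g w * p (h w) else 0"
proof -
  fix h :: "nat list \<Rightarrow> nat list" and g and p :: "nat list \<Rightarrow> 'f"
  assume "finite {k. p k \<noteq> 0}"
  then have "finite (h ` {k. p k \<noteq> 0})" by simp
  moreover have "{k. (if h (h k) = k then g k * p (h k) else 0) \<noteq> 0} \<subseteq> h ` {k. p k \<noteq> 0}"
    by (force split: if_splits)
  ultimately show "finite {k. (if h (h k) = k then g k * p (h k) else 0) \<noteq> 0}"
    by (rule rev_finite_subset)
qed

lemma tensor_twist_add: "tensor_twist h g (p + q) = tensor_twist h g p + tensor_twist h g q"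
  by (rule poly_mapping_eqI) (simp add: tensor_twist.rep_eq lookup_add algebra_simps)

lemma tensor_twist_zero: "tensor_twist h g 0 = 0"
  by (rule poly_mapping_eqI) (simp add: tensor_twist.rep_eq)

lemma tensor_twist_uminus: "tensor_twist h g (- p) = - tensor_twist h g p"
  by (rule poly_mapping_eqI) (simp add: tensor_twist.rep_eq)

lemma tensor_twist_diff: "tensor_twist h g (p - q) = tensor_twist h g p - tensor_twist h g q"
  by (rule poly_mapping_eqI) (simp add: tensor_twist.rep_eq lookup_minus algebra_simps)

lemma tensor_twist_sum: "tensor_twist h g (sum f A) = (\<Sum>x\<in>A. tensor_twist h g (f x))"
  by (induction A rule: infinite_finite_induct) (simp_all add: tensor_twist_zero tensor_twist_add)

lemma tensor_twist_single:
  assumes "\<And>w. h (h w) = w"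
  shows "tensor_twist h g (Poly_Mapping.single w a) = Poly_Mapping.single (h w) (g (h w) * a)"
  by (rule poly_mapping_eqI) (use assms in \<open>auto simp: tensor_twist.rep_eq lookup_single when_def\<close>)

lemma ring_isoD:
  assumes "f \<in> ring_iso R S" "x \<in> carrier R" "y \<in> carrier R"
  shows "f (x \<oplus>\<^bsub>R\<^esub> y) = f x \<oplus>\<^bsub>S\<^esub> f y" "f (x \<otimes>\<^bsub>R\<^esub> y) = f x \<otimes>\<^bsub>S\<^esub> f y"
  using assms by (auto simp: ring_iso_def ring_hom_def)

lemma opposite_simps [simp]:
  "carrier (opposite_ring R) = carrier R"
  "x \<otimes>\<^bsub>opposite_ring R\<^esub> y = y \<otimes>\<^bsub>R\<^esub> x"
  "x \<oplus>\<^bsub>opposite_ring R\<^esub> y = x \<oplus>\<^bsub>R\<^esub> y"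
  "\<one>\<^bsub>opposite_ring R\<^esub> = \<one>\<^bsub>R\<^esub>"
  "\<zero>\<^bsub>opposite_ring R\<^esub> = \<zero>\<^bsub>R\<^esub>"
  by (simp_all add: opposite_ring_def)

lemma tensor_vec_unit:
  "tensor_vec n (\<lambda>j. if j = i then 1 else 0) = (if i \<in> {1..n} then Poly_Mapping.single [i] 1 else 0)"
proof -
  have "tensor_vec n (\<lambda>j. if j = i then 1 else (0::'f::field)) =
      (\<Sum>j=1..n. if j = i then Poly_Mapping.single [i] 1 else 0)"
    unfolding tensor_vec_def by (rule sum.cong) auto
  then show ?thesis by (simp add: sum.delta)
qed

lemma clifford_gen_proj:
  "i \<in> {1..r+s} \<Longrightarrow> clifford_gen r s i = clifford_proj r s (Poly_Mapping.single [i] 1)"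
  by (simp add: clifford_gen_def clifford_vec_def tensor_vec_unit)

lemma clifford_hom_eqI:
  fixes f g :: "'f::field clifford \<Rightarrow> 'f clifford"
  assumes f: "f \<in> ring_iso (clifford_algebra r s) S" "clifford_linear r s f"
    and g: "g \<in> ring_iso (clifford_algebra r s) S" "clifford_linear r s g"
    and S: "ring S"
    and eq: "\<And>i. i \<in> {1..r+s} \<Longrightarrow> f (clifford_gen r s i) = g (clifford_gen r s i)"
    and x: "x \<in> carrier (clifford_algebra r s)"
  shows "f x = g x"
proof -
  interpret C: ring "clifford_algebra r s" by (rule clifford_ring)
  have words: "f (clifford_proj r s (Poly_Mapping.single w 1)) = g (clifford_proj r s (Poly_Mapping.single w 1))"
    if "set w \<subseteq> {1..r+s}" for w
    using that
  proof (induction w)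
    case Nil
    have "Poly_Mapping.single [] 1 = (1 :: 'f tensor)"
      using single_one by (metis zero_list_def)
    then have "clifford_proj r s (Poly_Mapping.single [] (1 :: 'f)) = \<one>\<^bsub>clifford_algebra r s\<^esub>"
      by (simp add: clifford_proj_one)
    then show ?case using f(1) g(1) by (simp add: ring_iso_def ring_hom_def)
  next
    case (Cons i w)
    have c: "Poly_Mapping.single [i] 1 \<in> carrier (tensor_algebra (r + s))"
       "Poly_Mapping.single w (1::'f) \<in> carrier (tensor_algebra (r + s))"
      using Cons.prems by (auto simp: tensor_carrier_iff)
    have e: "clifford_proj r s (Poly_Mapping.single (i # w) 1) =
        clifford_proj r s (Poly_Mapping.single [i] 1) \<otimes>\<^bsub>clifford_algebra r s\<^esub>
        clifford_proj r s (Poly_Mapping.single w (1::'f))"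
      using clifford_proj_mult[OF c] by (simp add: mult_single plus_list_def)
    have m: "clifford_proj r s (Poly_Mapping.single [i] (1::'f)) \<in> carrier (clifford_algebra r s)"
      "clifford_proj r s (Poly_Mapping.single w (1::'f)) \<in> carrier (clifford_algebra r s)"
      using c clifford_carrier by blast+
    have "f (clifford_proj r s (Poly_Mapping.single [i] 1)) = g (clifford_proj r s (Poly_Mapping.single [i] 1))"
      using eq[of i] Cons.prems clifford_gen_proj[of i r s, where ?'a='f] by auto
    then show ?case
      using Cons ring_isoD(2)[OF f(1) m] ring_isoD(2)[OF g(1) m] by (simp add: e)
  qed
  have single: "f (clifford_proj r s (Poly_Mapping.single w a)) = g (clifford_proj r s (Poly_Mapping.single w a))"
    if "set w \<subseteq> {1..r+s}" for w a
  proof -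
    have c: "Poly_Mapping.single w (1::'f) \<in> carrier (tensor_algebra (r + s))" using that by (auto simp: tensor_carrier_iff)
    have "Poly_Mapping.single w a = tensor_scalar a * Poly_Mapping.single w 1"
      by (simp add: tensor_scalar_def mult_single plus_list_def)
    then have "clifford_proj r s (Poly_Mapping.single w a) =
        clifford_smult r s a (clifford_proj r s (Poly_Mapping.single w 1))"
      using clifford_smult_proj[OF c] by simp
    moreover have "clifford_proj r s (Poly_Mapping.single w (1::'f)) \<in> carrier (clifford_algebra r s)"
      using c clifford_carrier by blast
    ultimately show ?thesis
      using f(2) g(2) words[OF that] by (simp add: clifford_linear_def)
  qed
  have proj: "f (clifford_proj r s p) = g (clifford_proj r s p)" if "p \<in> carrier (tensor_algebra (r + s))" for p
    using that
  proof (induction p rule: tensor_induct)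
    case zero
    show ?case using single[of "[]" 0] by simp
  next
    case (single w a)
    then show ?case by (rule \<open>\<And>w a. set w \<subseteq> {1..r+s} \<Longrightarrow> f (clifford_proj r s (Poly_Mapping.single w a)) = g (clifford_proj r s (Poly_Mapping.single w a))\<close>)
  next
    case (add p q)
    then have m: "clifford_proj r s p \<in> carrier (clifford_algebra r s)"
      "clifford_proj r s q \<in> carrier (clifford_algebra r s)"
      using clifford_carrier by blast+
    show ?case
      using add ring_isoD(1)[OF f(1) m] ring_isoD(1)[OF g(1) m] clifford_proj_add[OF add.hyps]
      by simp
  qed
  show ?thesis using x proj unfolding clifford_carrier by blast
qed


lemma clifford_induced:
  fixes \<phi> :: "'f::field tensor \<Rightarrow> 'f tensor" and S :: "'f clifford ring"
  assumes T_def: "T = (tensor_algebra (r + s) :: 'f tensor ring)"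
    and closed: "\<And>p. p \<in> carrier T \<Longrightarrow> \<phi> p \<in> carrier T"
    and add: "\<And>p q. \<phi> (p + q) = \<phi> p + \<phi> q"
    and minus: "\<And>p q. \<phi> (p - q) = \<phi> p - \<phi> q"
    and one: "\<phi> 1 = 1"
    and invol: "\<And>p. \<phi> (\<phi> p) = p"
    and scalar: "\<And>a p. \<phi> (tensor_scalar a * p) = tensor_scalar a * \<phi> p"
    and mult: "(\<forall>p q. \<phi> (p * q) = \<phi> p * \<phi> q) \<and> S = clifford_algebra r s \<or>
               (\<forall>p q. \<phi> (p * q) = \<phi> q * \<phi> p) \<and> S = opposite_ring (clifford_algebra r s)"
    and rel: "\<And>v. \<phi> (tensor_vec (r + s) v * tensor_vec (r + s) v + tensor_scalar (Q_form r s v v))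
                  \<in> clifford_ideal r s"
  obtains f where "f \<in> extensional (carrier (clifford_algebra r s))"
    and "f \<in> ring_iso (clifford_algebra r s) S" and "clifford_linear r s f"
    and "\<And>p. p \<in> carrier T \<Longrightarrow> f (clifford_proj r s p) = clifford_proj r s (\<phi> p)"
proof -
  let ?C = "clifford_algebra r s :: 'f clifford ring"
  let ?I = "clifford_ideal r s :: 'f tensor set"
  interpret T: ring T unfolding T_def by (rule tensor_ring)
  interpret I: ideal ?I T unfolding T_def by (rule clifford_ideal)
  have T_simps: "p \<otimes>\<^bsub>T\<^esub> q = p * q" "p \<oplus>\<^bsub>T\<^esub> q = p + q" "\<one>\<^bsub>T\<^esub> = 1" "\<zero>\<^bsub>T\<^esub> = 0" for p q
    by (simp_all add: T_def)
  have T_minus: "p \<in> carrier T \<Longrightarrow> \<ominus>\<^bsub>T\<^esub> p = - p" for p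
    by (simp add: T_def tensor_minus)
  have zero: "\<phi> 0 = 0" using minus[of 0 0] by simp
  have uminus: "\<phi> (- p) = - \<phi> p" for p using minus[of 0 p] zero by simp
  have I_sub: "\<phi> p \<in> ?I" if "p \<in> ?I" for p
  proof -
    let ?J = "{p \<in> carrier T. \<phi> p \<in> ?I}"
    have "ideal ?J T"
    proof (rule idealI)
      show "ring T" by (rule T.ring_axioms)
      show "subgroup ?J (add_monoid T)"
      proof (rule T.add.subgroupI)
        show "?J \<noteq> {}"
          using T.zero_closed I.zero_closed zero by (metis (no_types, lifting) T_simps(4) empty_iff mem_Collect_eq)
        fix p assume p: "p \<in> ?J"
        then show "\<ominus>\<^bsub>T\<^esub> p \<in> ?J"
          using T.a_inv_closed[of p] I.a_inv_closed[of "\<phi> p"] closed[of p]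
          by (simp add: T_minus uminus)
      next
        fix p q assume "p \<in> ?J" "q \<in> ?J"
        then show "p \<oplus>\<^bsub>T\<^esub> q \<in> ?J"
          using T.a_closed[of p q] I.a_closed[of "\<phi> p" "\<phi> q"] by (simp add: T_simps add)
      qed auto
      fix p x assume p: "p \<in> ?J" and x: "x \<in> carrier T"
      then have *: "\<phi> x * \<phi> p \<in> ?I" "\<phi> p * \<phi> x \<in> ?I" "x * p \<in> carrier T" "p * x \<in> carrier T"
        using I.I_l_closed[of "\<phi> p" "\<phi> x"] I.I_r_closed[of "\<phi> p" "\<phi> x"] closed[of x]
          T.m_closed[of x p] T.m_closed[of p x] by (simp_all add: T_simps)
      have "\<phi> (x * p) \<in> ?I" "\<phi> (p * x) \<in> ?I"
        using mult *(1,2) by metis+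
      then show "x \<otimes>\<^bsub>T\<^esub> p \<in> ?J" "p \<otimes>\<^bsub>T\<^esub> x \<in> ?J"
        using *(3,4) by (simp_all add: T_simps)
    qed
    moreover have "{tensor_vec (r + s) v * tensor_vec (r + s) v + tensor_scalar (Q_form r s v v) | v. True}
        \<subseteq> ?J"
      using rel tensor_relators_closed[of r s] unfolding T_def by blast
    ultimately have "?I \<subseteq> ?J"
      unfolding clifford_ideal_def T_def by (rule ring.genideal_minimal[OF tensor_ring])
    then show ?thesis using that by auto
  qed
  define f where "f = (\<lambda>x\<in>carrier ?C. clifford_proj r s (\<phi> (SOME p. p \<in> carrier T \<and> clifford_proj r s p = x)))"
  have C: "carrier ?C = clifford_proj r s ` carrier T"
    unfolding T_def by (rule clifford_carrier)
  have f: "f (clifford_proj r s p) = clifford_proj r s (\<phi> p)" if p: "p \<in> carrier T" for p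
  proof -
    define q where "q = (SOME q. q \<in> carrier T \<and> clifford_proj r s q = clifford_proj r s p)"
    have "\<exists>q. q \<in> carrier T \<and> clifford_proj r s q = clifford_proj r s p" using p by blast
    from someI_ex[OF this] have "q \<in> carrier T \<and> clifford_proj r s q = clifford_proj r s p"
      by (simp only: q_def)
    then have q: "q \<in> carrier T" "q - p \<in> ?I"
      using clifford_proj_eq_iff[of q r s p] p by (auto simp: T_def)
    have "clifford_proj r s (\<phi> q) = clifford_proj r s (\<phi> p)"
      using I_sub[OF q(2)] clifford_proj_eq_iff[of "\<phi> q" r s "\<phi> p"] closed[OF p] closed[OF q(1)]
      by (simp add: T_def minus)
    moreover have "clifford_proj r s p \<in> carrier ?C" using p C by blast
    ultimately show ?thesis by (simp add: f_def q_def)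
  qed
  have fC: "f x \<in> carrier ?C" "f (f x) = x" if "x \<in> carrier ?C" for x
  proof -
    from that obtain p where p: "p \<in> carrier T" and x: "x = clifford_proj r s p"
      unfolding C by (elim imageE)
    have fp: "f x = clifford_proj r s (\<phi> p)" by (simp only: x f[OF p])
    then show "f x \<in> carrier ?C" using closed[OF p] by (simp only: C imageI)
    show "f (f x) = x" by (simp only: x f[OF p] f[OF closed[OF p]] invol)
  qed
  have "S = ?C \<or> S = opposite_ring ?C" by (rule disj_forward[OF mult]) (erule conjunct2)+
  then have S: "carrier S = carrier ?C" "x \<oplus>\<^bsub>S\<^esub> y = x \<oplus>\<^bsub>?C\<^esub> y" "\<one>\<^bsub>S\<^esub> = \<one>\<^bsub>?C\<^esub>" for x y
    by auto
  have "f \<in> ring_iso ?C S"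
  proof (rule ring_iso_memI)
    fix x y assume "x \<in> carrier ?C" "y \<in> carrier ?C"
    then obtain p q where pq: "p \<in> carrier T" "q \<in> carrier T"
      and xy: "x = clifford_proj r s p" "y = clifford_proj r s q"
      unfolding C by auto
    note pq' = pq[unfolded T_def]
    have c: "p + q \<in> carrier T" "p * q \<in> carrier T"
      using T.a_closed[OF pq] T.m_closed[OF pq] by (simp_all add: T_simps)
    have \<phi>: "\<phi> p \<in> carrier (tensor_algebra (r + s))" "\<phi> q \<in> carrier (tensor_algebra (r + s))"
      using closed pq by (simp_all add: T_def)
    show "f (x \<oplus>\<^bsub>?C\<^esub> y) = f x \<oplus>\<^bsub>S\<^esub> f y"
      by (simp add: xy S clifford_proj_add[OF pq'] clifford_proj_add[OF \<phi>] f pq c add)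
    show "f (x \<otimes>\<^bsub>?C\<^esub> y) = f x \<otimes>\<^bsub>S\<^esub> f y"
      using mult
    proof
      assume "(\<forall>p q. \<phi> (p * q) = \<phi> p * \<phi> q) \<and> S = ?C"
      then have "\<phi> (p * q) = \<phi> p * \<phi> q" "S = ?C" by simp_all
      then show ?thesis
        by (simp add: xy clifford_proj_mult[OF pq'] clifford_proj_mult[OF \<phi>] f pq c)
    next
      assume "(\<forall>p q. \<phi> (p * q) = \<phi> q * \<phi> p) \<and> S = opposite_ring ?C"
      then have "\<phi> (p * q) = \<phi> q * \<phi> p" "S = opposite_ring ?C" by simp_all
      then show ?thesis
        by (simp add: xy clifford_proj_mult[OF pq'] clifford_proj_mult[OF \<phi>(2,1)] f pq c)
    qed
  next
    show "f \<one>\<^bsub>?C\<^esub> = \<one>\<^bsub>S\<^esub>"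
      using f[of 1] T.one_closed by (simp add: S clifford_proj_one one T_simps)
    show "bij_betw f (carrier ?C) (carrier S)"
      by (rule bij_betw_byWitness[where f' = f]) (use fC in \<open>auto simp: S\<close>)
  qed (use fC S in auto)
  moreover have "clifford_linear r s f"
    unfolding clifford_linear_def
  proof (intro allI ballI)
    fix a x assume "x \<in> carrier ?C"
    then obtain p where p: "p \<in> carrier T" "x = clifford_proj r s p" unfolding C by auto
    have "tensor_scalar a * p \<in> carrier T"
      using p tensor_mult_closed[OF tensor_scalar_closed] by (auto simp: T_def)
    then show "f (clifford_smult r s a x) = clifford_smult r s a (f x)"
      using p closed[OF p(1)] clifford_smult_proj[of p r s a] clifford_smult_proj[of "\<phi> p" r s a] f
      by (simp add: scalar T_def)
  qed
  moreover have "f \<in> extensional (carrier ?C)" by (simp add: f_def)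
  ultimately show thesis using that f by blast
qed

lemma tensor_decomp: "p = (\<Sum>w\<in>Poly_Mapping.keys p. Poly_Mapping.single w (Poly_Mapping.lookup p w))"
  by (rule poly_mapping_eqI)
    (auto simp: lookup_sum lookup_single when_def in_keys_iff sum.delta' sum.delta)

lemma tensor_bilinear_eqI:
  fixes A B :: "'f::field tensor \<Rightarrow> 'f tensor \<Rightarrow> 'f tensor"
  assumes "\<And>p p' q. A (p + p') q = A p q + A p' q" "\<And>p q q'. A p (q + q') = A p q + A p q'"
    and "\<And>p p' q. B (p + p') q = B p q + B p' q" "\<And>p q q'. B p (q + q') = B p q + B p q'"
    and "\<And>u v a b. A (Poly_Mapping.single u a) (Poly_Mapping.single v b) =
      B (Poly_Mapping.single u a) (Poly_Mapping.single v b)"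
  shows "A p q = B p q"
proof -
  have n: "A 0 q = 0" "A p 0 = 0" "B 0 q = 0" "B p 0 = 0" for p q
    using assms(1)[of 0 0 q] assms(2)[of p 0 0] assms(3)[of 0 0 q] assms(4)[of p 0 0] by simp_all
  have Al: "A (sum F X) q = (\<Sum>x\<in>X. A (F x) q)" for F :: "nat list \<Rightarrow> _" and X q
    by (induction X rule: infinite_finite_induct) (simp_all add: assms n)
  have Ar: "A p (sum F X) = (\<Sum>x\<in>X. A p (F x))" for F :: "nat list \<Rightarrow> _" and X p
    by (induction X rule: infinite_finite_induct) (simp_all add: assms n)
  have Bl: "B (sum F X) q = (\<Sum>x\<in>X. B (F x) q)" for F :: "nat list \<Rightarrow> _" and X q
    by (induction X rule: infinite_finite_induct) (simp_all add: assms n)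
  have Br: "B p (sum F X) = (\<Sum>x\<in>X. B p (F x))" for F :: "nat list \<Rightarrow> _" and X p
    by (induction X rule: infinite_finite_induct) (simp_all add: assms n)
  let ?s = "\<lambda>p. \<Sum>w\<in>Poly_Mapping.keys p. Poly_Mapping.single w (Poly_Mapping.lookup p w)"
  have "A (?s p) (?s q) = B (?s p) (?s q)"
    by (simp add: Al Ar Bl Br assms(5))
  then show ?thesis by (simp only: tensor_decomp[symmetric])
qed

lemma tensor_twist_closed:
  assumes "\<And>w. set (h w) = set w" "p \<in> carrier (tensor_algebra n)"
  shows "tensor_twist h g p \<in> carrier (tensor_algebra n)"
  unfolding tensor_carrier_iff
proof
  fix w assume "w \<in> Poly_Mapping.keys (tensor_twist h g p)"
  then have "h w \<in> Poly_Mapping.keys p"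
    by (auto simp: in_keys_iff tensor_twist.rep_eq split: if_splits)
  then show "set w \<subseteq> {1..n}" using assms(2) assms(1)[of w] unfolding tensor_carrier_iff by blast
qed

lemma tensor_twist_involution:
  assumes "\<And>w. h (h w) = w" "\<And>w. g w * g (h w) = 1"
  shows "tensor_twist h g (tensor_twist h g p) = p"
  by (rule poly_mapping_eqI) (simp add: tensor_twist.rep_eq assms flip: mult.assoc)

lemma tensor_single_mult:
  "Poly_Mapping.single u a * Poly_Mapping.single v b = Poly_Mapping.single (u @ v) (a * b :: 'f::field)"
  by (simp add: mult_single plus_list_def)

lemma tensor_one: "(1 :: 'f::field tensor) = Poly_Mapping.single [] 1"
  by (metis single_one zero_list_def)

lemma tensor_scalar_commute: "p * tensor_scalar a = tensor_scalar a * p"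
proof -
  have "p * q * tensor_scalar a = tensor_scalar a * p * q" for q
    by (rule tensor_bilinear_eqI[where A = "\<lambda>p q. p * q * tensor_scalar a" and
        B = "\<lambda>p q. tensor_scalar a * p * q"])
      (simp_all add: distrib_left distrib_right tensor_single_mult tensor_scalar_def ac_simps)
  from this[of 1] show ?thesis by simp
qed

lemma clifford_relator_in_ideal:
  "tensor_vec (r + s) v * tensor_vec (r + s) v + tensor_scalar (Q_form r s v v) \<in> clifford_ideal r s"
  unfolding clifford_ideal_def
  using ring.genideal_self[OF tensor_ring tensor_relators_closed] by blast

lemma tensor_vec_uminus: "tensor_vec n (\<lambda>i. - v i) = - tensor_vec n v"
  by (simp add: tensor_vec_def single_uminus sum_negf)

lemma Q_form_cong_sign:
  assumes "\<And>i. e i * e i = (1 :: 'f::field)"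
  shows "Q_form r s (\<lambda>i. e i * v i) (\<lambda>i. e i * v i) = Q_form r s v v"
proof -
  have "e i * v i * (e i * v i) = v i * v i" for i
  proof -
    have "e i * v i * (e i * v i) = (e i * e i) * (v i * v i)" by (simp only: ac_simps)
    then show ?thesis by (simp add: assms)
  qed
  then show ?thesis by (simp only: Q_form_def)
qed

text \<open>The twists reversing words, resp. keeping them, with sign \<open>e i\<close> for each letter \<open>i\<close>.\<close>

lemma clifford_signed_hom:
  fixes e :: "nat \<Rightarrow> 'f::field" and h :: "nat list \<Rightarrow> nat list"
  assumes e: "\<And>i. e i * e i = 1"
    and S: "h = (\<lambda>w. w) \<and> S = clifford_algebra r s \<or>
       h = rev \<and> S = opposite_ring (clifford_algebra r s)"
  obtains f where "f \<in> extensional (carrier (clifford_algebra r s))"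
    and "f \<in> ring_iso (clifford_algebra r s) S" and "clifford_linear r s f"
    and "\<And>v. f (clifford_vec r s v) = clifford_vec r s (\<lambda>i. e i * v i)"
proof -
  define g where "g w = prod_list (map e w)" for w
  let ?\<phi> = "tensor_twist h g"
  have g: "g (u @ v) = g u * g v" "g [] = 1" "g [i] = e i" for u v i
    by (simp_all add: g_def)
  have gr: "g (rev w) = g w" for w by (induction w) (simp_all add: g_def)
  have gg: "g w * g w = 1" for w
  proof (induction w)
    case (Cons i w)
    have "g (i # w) * g (i # w) = (e i * e i) * (g w * g w)"
      by (simp add: g_def ac_simps)
    then show ?case using Cons e by simp
  qed (simp add: g_def)
  have h: "h (h w) = w" "set (h w) = set w" "g (h w) = g w" "h [] = []" "h [i] = [i]" for w i
    using S by (auto simp: gr)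
  note single = tensor_twist_single[of h, OF h(1)]
  have scal: "?\<phi> (tensor_scalar a) = tensor_scalar a" for a
    by (simp add: tensor_scalar_def single h g)
  have vec: "?\<phi> (tensor_vec (r + s) v) = tensor_vec (r + s) (\<lambda>i. e i * v i)" for v
    by (simp add: tensor_vec_def tensor_twist_sum single h g)
  have m1: "?\<phi> (p * q) = ?\<phi> p * ?\<phi> q" if "h = (\<lambda>w. w)" for p q
  proof (rule tensor_bilinear_eqI[where A = "\<lambda>p q. ?\<phi> (p * q)" and B = "\<lambda>p q. ?\<phi> p * ?\<phi> q"])
    fix u v :: "nat list" and a b :: 'f
    have "h (u @ v) = h u @ h v" using that by simp
    then show "?\<phi> (Poly_Mapping.single u a * Poly_Mapping.single v b) = ?\<phi> (Poly_Mapping.single u a) * ?\<phi> (Poly_Mapping.single v b)"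
      by (simp add: tensor_single_mult single g h ac_simps)
  qed (simp_all add: algebra_simps tensor_twist_add)
  have m2: "?\<phi> (p * q) = ?\<phi> q * ?\<phi> p" if "h = rev" for p q
  proof (rule tensor_bilinear_eqI[where A = "\<lambda>p q. ?\<phi> (p * q)" and B = "\<lambda>p q. ?\<phi> q * ?\<phi> p"])
    fix u v :: "nat list" and a b :: 'f
    have "h (u @ v) = h v @ h u" using that by simp
    then show "?\<phi> (Poly_Mapping.single u a * Poly_Mapping.single v b) = ?\<phi> (Poly_Mapping.single v b) * ?\<phi> (Poly_Mapping.single u a)"
      by (simp add: tensor_single_mult single g h ac_simps)
  qed (simp_all add: algebra_simps tensor_twist_add)
  have mult: "(\<forall>p q. ?\<phi> (p * q) = ?\<phi> p * ?\<phi> q) \<and> S = clifford_algebra r s \<or>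
      (\<forall>p q. ?\<phi> (p * q) = ?\<phi> q * ?\<phi> p) \<and> S = opposite_ring (clifford_algebra r s)"
    using S m1 m2 by blast
  have square: "?\<phi> (p * p) = ?\<phi> p * ?\<phi> p" for p
    using S m1 m2 by blast
  obtain f where f: "f \<in> extensional (carrier (clifford_algebra r s))"
    "f \<in> ring_iso (clifford_algebra r s) S" "clifford_linear r s f"
    "\<And>p. p \<in> carrier (tensor_algebra (r + s)) \<Longrightarrow> f (clifford_proj r s p) = clifford_proj r s (?\<phi> p)"
  proof (rule clifford_induced[OF refl, of r s ?\<phi> S])
    show "?\<phi> p \<in> carrier (tensor_algebra (r + s))" if "p \<in> carrier (tensor_algebra (r + s))" for p
      using that by (rule tensor_twist_closed[rotated]) (rule h)
    show "?\<phi> 1 = 1" by (simp add: tensor_one single h g)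
    show "?\<phi> (?\<phi> p) = p" for p
      by (rule tensor_twist_involution) (simp_all add: h gg)
    show "?\<phi> (tensor_scalar a * p) = tensor_scalar a * ?\<phi> p" for a p
    proof -
      have "?\<phi> (tensor_scalar a * p) \<in>
          {?\<phi> (tensor_scalar a) * ?\<phi> p, ?\<phi> p * ?\<phi> (tensor_scalar a)}"
        using S m1 m2 by blast
      then show ?thesis unfolding scal tensor_scalar_commute by simp
    qed
    show "?\<phi> (tensor_vec (r + s) v * tensor_vec (r + s) v + tensor_scalar (Q_form r s v v))
        \<in> clifford_ideal r s" for v
      using clifford_relator_in_ideal[of r s "\<lambda>i. e i * v i"]
      by (simp add: tensor_twist_add square scal vec Q_form_cong_sign[OF e])
  qed (use mult in \<open>auto simp: tensor_twist_add tensor_twist_diff\<close>)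
  have "f (clifford_vec r s v) = clifford_vec r s (\<lambda>i. e i * v i)" for v
    by (simp add: clifford_vec_def f(4)[OF tensor_vec_closed] vec)
  then show thesis using that f by blast
qed

lemma opposite_clifford_ring: "ring (opposite_ring (clifford_algebra r s))"
proof -
  interpret C: ring "clifford_algebra r s" by (rule clifford_ring)
  show ?thesis
  proof (rule ringI)
    show "abelian_group (opposite_ring (clifford_algebra r s))"
      by (rule abelian_groupI) (auto simp: C.a_ac intro: C.l_neg)
    show "Group.monoid (opposite_ring (clifford_algebra r s))"
      by (rule monoidI) (simp_all add: C.m_assoc)
  qed (simp_all add: C.l_distr C.r_distr)
qed

lemma clifford_vec_uminus:
  "clifford_vec r s (\<lambda>i. - v i) = \<ominus>\<^bsub>clifford_algebra r s\<^esub> clifford_vec r s v"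
  unfolding clifford_vec_def tensor_vec_uminus
  by (rule clifford_proj_uminus[OF tensor_vec_closed, symmetric])

lemma clifford_c_ex1:
  "\<exists>!c :: 'f::field clifford \<Rightarrow> 'f clifford. c \<in> extensional (carrier (clifford_algebra r s)) \<and>
     clifford_antiautomorphism r s c \<and>
     (\<forall>v. c (clifford_vec r s v) = \<ominus>\<^bsub>clifford_algebra r s\<^esub> clifford_vec r s v)"
  (is "\<exists>!c. ?P c")
proof (rule ex_ex1I)
  obtain f :: "'f clifford \<Rightarrow> 'f clifford" where
    "f \<in> extensional (carrier (clifford_algebra r s))"
    "f \<in> ring_iso (clifford_algebra r s) (opposite_ring (clifford_algebra r s))"
    "clifford_linear r s f"
    "\<And>v. f (clifford_vec r s v) = clifford_vec r s (\<lambda>i. (- 1) * v i)"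
    by (rule clifford_signed_hom[of "\<lambda>_. - 1" rev "opposite_ring (clifford_algebra r s)" r s]) auto
  then show "\<exists>c. ?P c"
    by (intro exI[of _ f]) (simp add: clifford_antiautomorphism_def clifford_vec_uminus)
next
  fix f g assume f: "?P f" and g: "?P g"
  show "f = g"
  proof (rule extensionalityI)
    show "f x = g x" if "x \<in> carrier (clifford_algebra r s)" for x
      by (rule clifford_hom_eqI[of f r s "opposite_ring (clifford_algebra r s)" g])
        (use f g that in \<open>auto simp: clifford_antiautomorphism_def clifford_gen_def opposite_clifford_ring\<close>)
  qed (use f g in auto)
qed

lemma clifford_beta_ex1:
  "\<exists>!b :: 'f::field clifford \<Rightarrow> 'f clifford. b \<in> extensional (carrier (clifford_algebra r s)) \<and>
     clifford_automorphism r s b \<and>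
     (\<forall>i\<in>{1..r}. b (clifford_gen r s i) = clifford_gen r s i) \<and>
     (\<forall>j\<in>{1..s}. b (clifford_gen r s (r + j)) =
        \<ominus>\<^bsub>clifford_algebra r s\<^esub> clifford_gen r s (r + j))"
  (is "\<exists>!b. ?P b")
proof (rule ex_ex1I)
  define e :: "nat \<Rightarrow> 'f" where "e i = (if i \<le> r then 1 else - 1)" for i
  obtain f :: "'f clifford \<Rightarrow> 'f clifford" where f:
    "f \<in> extensional (carrier (clifford_algebra r s))"
    "f \<in> ring_iso (clifford_algebra r s) (clifford_algebra r s)"
    "clifford_linear r s f"
    "\<And>v. f (clifford_vec r s v) = clifford_vec r s (\<lambda>i. e i * v i)"
    by (rule clifford_signed_hom[of e "\<lambda>w. w" "clifford_algebra r s" r s]) (auto simp: e_def)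
  have "(\<lambda>j. e j * (if j = i then 1 else 0)) = (\<lambda>j. if j = i then 1 else 0)" if "i \<le> r" for i
    using that by (auto simp: e_def)
  moreover have "(\<lambda>j. e j * (if j = i then 1 else 0)) = (\<lambda>j. - (if j = i then 1 else 0))" if "i > r" for i
    using that by (auto simp: e_def)
  ultimately show "\<exists>b. ?P b"
    using f by (intro exI[of _ f])
      (simp add: clifford_automorphism_def clifford_gen_def clifford_vec_uminus)
next
  fix f g assume f: "?P f" and g: "?P g"
  have gen: "f (clifford_gen r s i) = g (clifford_gen r s i)" if "i \<in> {1..r+s}" for i
  proof (cases "i \<le> r")
    case True
    then show ?thesis using f g that by auto
  next
    case False
    then have "i = r + (i - r)" "i - r \<in> {1..s}" using that by auto
    then obtain j where "i = r + j" "j \<in> {1..s}" by blast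
    then show ?thesis using f g by auto
  qed
  show "f = g"
  proof (rule extensionalityI)
    show "f x = g x" if "x \<in> carrier (clifford_algebra r s)" for x
      by (rule clifford_hom_eqI[of f r s "clifford_algebra r s" g])
        (use f g that gen in \<open>auto simp: clifford_automorphism_def clifford_ring\<close>)
  qed (use f g in auto)
qed

lemmas clifford_c_props = theI'[OF clifford_c_ex1, folded clifford_c_def]

lemmas clifford_beta_props = theI'[OF clifford_beta_ex1, folded clifford_beta_def]

end

theory Submission
  imports Defs
begin

text \<open>Every \<open>e\<^sub>I\<close> is an eigenvector with eigenvalue \<open>\<plusminus>1\<close> of the linear maps \<open>-c\<close>, \<open>\<beta>\<close> and
  conjugation by \<open>e\<^sub>J\<close>. If a linear map \<open>T\<close> is of this kind and \<open>T x = x\<close>, then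
  \<open>x = (x + T x) / 2\<close> shows that the terms \<open>e\<^sub>I\<close> with \<open>T e\<^sub>I = -e\<^sub>I\<close> can be dropped from any
  expression of \<open>x\<close> as a combination of the \<open>e\<^sub>I\<close>. Hence a shortest expression of an element of
  the center only involves \<open>e\<^sub>I\<close> that lie in \<open>\<KK>\<close> and commute with all \<open>e\<^sub>J \<in> \<KK>\<close>; as these \<open>e\<^sub>J\<close>
  span \<open>\<KK>\<close>, such \<open>e\<^sub>I\<close> are central. Linear independence of the \<open>e\<^sub>I\<close> is never needed.\<close>

interpretation clifford: ring "clifford_algebra r s" for r s :: nat
  by (rule clifford_ring)

section \<open>Linear maps acting by signs, and the monomials e_I\<close>

context
  fixes r s :: nat
begin

abbreviation C :: "'f::field clifford ring" where
  "C \<equiv> clifford_algebra r s"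

text \<open>Only linearity is asked for, so that the notion covers x -> -c(x), which is not
  multiplicative in general, together with beta and conjugations.\<close>

definition linear_endo :: "('f::field clifford \<Rightarrow> 'f clifford) \<Rightarrow> bool" where
  "linear_endo T \<longleftrightarrow> clifford_linear r s T \<and> (\<forall>x\<in>carrier C. T x \<in> carrier C) \<and>
     (\<forall>x\<in>carrier C. \<forall>y\<in>carrier C. T (x \<oplus>\<^bsub>C\<^esub> y) = T x \<oplus>\<^bsub>C\<^esub> T y)"

text \<open>Membership of \<open>y\<close> in the carrier is built in and passes to
  \<open>x\<close>, so that chains of such relations carry closure along.\<close>

definition upto_sign :: "'f::field clifford \<Rightarrow> 'f clifford \<Rightarrow> bool" where
  "upto_sign x y \<longleftrightarrow> y \<in> carrier C \<and> (x = y \<or> x = \<ominus>\<^bsub>C\<^esub> y)"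

definition sign_diagonal :: "'f::field clifford set \<Rightarrow> ('f clifford \<Rightarrow> 'f clifford) \<Rightarrow> bool" where
  "sign_diagonal S T \<longleftrightarrow> linear_endo T \<and> (\<forall>y\<in>S. upto_sign (T y) y)"

definition monomials :: "'f::field clifford set" where
  "monomials = {clifford_basis r s I | I. sorted_wrt (<) I \<and> set I \<subseteq> {1..r+s}}"


subsection \<open>Scalar multiplication and spans\<close>

lemma scalar_closed: "clifford_proj r s (tensor_scalar a) \<in> carrier C"
  using tensor_scalar_closed clifford_carrier by blast

lemma smult_closed [simp, intro]: "x \<in> carrier C \<Longrightarrow> clifford_smult r s a x \<in> carrier C"
  by (simp add: clifford_smult_def scalar_closed)

lemma smult_add_right:
  "x \<in> carrier C \<Longrightarrow> y \<in> carrier C \<Longrightarrow>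
     clifford_smult r s a (x \<oplus>\<^bsub>C\<^esub> y) = clifford_smult r s a x \<oplus>\<^bsub>C\<^esub> clifford_smult r s a y"
  by (simp add: clifford_smult_def scalar_closed clifford.r_distr)

lemma smult_add_left:
  assumes "x \<in> carrier C"
  shows "clifford_smult r s (a + b) x = clifford_smult r s a x \<oplus>\<^bsub>C\<^esub> clifford_smult r s b x"
proof -
  have "tensor_scalar (a + b) = tensor_scalar a + tensor_scalar b"
    by (simp add: tensor_scalar_def single_add)
  then show ?thesis
    using assms by (simp add: clifford_smult_def scalar_closed clifford.l_distr
        flip: clifford_proj_add[OF tensor_scalar_closed tensor_scalar_closed])
qed

lemma smult_smult:
  assumes "x \<in> carrier C"
  shows "clifford_smult r s a (clifford_smult r s b x) = clifford_smult r s (a * b) x"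
proof -
  have "tensor_scalar (a * b) = tensor_scalar a * tensor_scalar b"
    by (simp add: tensor_scalar_def tensor_single_mult)
  then show ?thesis
    using assms by (simp add: clifford_smult_def scalar_closed clifford.m_assoc
        flip: clifford_proj_mult[OF tensor_scalar_closed tensor_scalar_closed])
qed

lemma scalar_one: "clifford_proj r s (tensor_scalar 1) = \<one>\<^bsub>C\<^esub>"
  by (simp add: tensor_scalar_def clifford_proj_one tensor_one)

lemma smult_one: "x \<in> carrier C \<Longrightarrow> clifford_smult r s 1 x = x"
  by (simp add: clifford_smult_def scalar_one)

lemma smult_zero_right: "clifford_smult r s a \<zero>\<^bsub>C\<^esub> = \<zero>\<^bsub>C\<^esub>"
  by (simp add: clifford_smult_def scalar_closed)

lemma smult_zero_left: "x \<in> carrier C \<Longrightarrow> clifford_smult r s 0 x = \<zero>\<^bsub>C\<^esub>"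
  by (simp add: clifford_smult_def tensor_scalar_def flip: clifford_proj_zero)

lemma smult_minus_right:
  "x \<in> carrier C \<Longrightarrow> clifford_smult r s a (\<ominus>\<^bsub>C\<^esub> x) = \<ominus>\<^bsub>C\<^esub> clifford_smult r s a x"
  by (simp add: clifford_smult_def scalar_closed clifford.r_minus)

lemma smult_mult_left:
  "x \<in> carrier C \<Longrightarrow> y \<in> carrier C \<Longrightarrow>
     clifford_smult r s a x \<otimes>\<^bsub>C\<^esub> y = clifford_smult r s a (x \<otimes>\<^bsub>C\<^esub> y)"
  by (simp add: clifford_smult_def scalar_closed clifford.m_assoc)

text \<open>\<open>clifford_smult\<close> is left multiplication by the class of a scalar, so
  centrality needs an argument. It holds before passing to the quotient: a scalar is a multiple of
  the empty word, which commutes with every tensor.\<close>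

lemma scalar_central:
  assumes "x \<in> carrier C"
  shows "x \<otimes>\<^bsub>C\<^esub> clifford_proj r s (tensor_scalar a) = clifford_smult r s a x"
proof -
  obtain p where p: "p \<in> carrier (tensor_algebra (r + s))" "x = clifford_proj r s p"
    using assms clifford_carrier by blast
  show ?thesis
    by (simp add: p clifford_smult_proj clifford_proj_mult tensor_scalar_closed tensor_scalar_commute)
qed

lemma smult_mult_right:
  assumes "x \<in> carrier C" "y \<in> carrier C"
  shows "x \<otimes>\<^bsub>C\<^esub> clifford_smult r s a y = clifford_smult r s a (x \<otimes>\<^bsub>C\<^esub> y)"
proof -
  have "x \<otimes>\<^bsub>C\<^esub> clifford_smult r s a y = clifford_smult r s a x \<otimes>\<^bsub>C\<^esub> y"
    using assms scalar_closed[of a]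
    by (simp only: clifford_smult_def[of r s a y] clifford.m_assoc[symmetric] scalar_central)
  then show ?thesis using assms by (simp add: smult_mult_left)
qed

text \<open>All later uses of the hypothesis on the characteristic go through this division by
  2.\<close>

lemma half_double:
  assumes "CHAR('f::field) \<noteq> 2" "(x :: 'f clifford) \<in> carrier C"
  shows "clifford_smult r s (1 / 2) (x \<oplus>\<^bsub>C\<^esub> x) = x"
proof -
  have "(2 :: 'f) \<noteq> 0"
  proof
    assume "(2 :: 'f) = 0"
    then have "of_nat 2 = (0 :: 'f)" by simp
    \<comment> \<open>A divisor of 2 is 1 or 2; characteristic 1 is impossible in a field, and 2 is
      excluded by hypothesis.\<close>
    then have "CHAR('f) dvd 2" by (simp only: of_nat_eq_0_iff_char_dvd)
    then have "CHAR('f) \<le> 2" "CHAR('f) \<noteq> 0" by (auto dest: dvd_imp_le intro!: gr0I)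
    then show False using assms(1) CHAR_not_1'[where ?'a = 'f] by linarith
  qed
  then have "(1 / 2 + 1 / 2 :: 'f) = 1" by simp
  then show ?thesis
    using assms(2) by (simp add: smult_add_right smult_one flip: smult_add_left)
qed

section \<open>Linear spans inside the Clifford algebra\<close>

lemma clifford_spanI:
  assumes "finite A" "A \<subseteq> S" "x = finsum C (\<lambda>y. clifford_smult r s (a y) y) A"
  shows "x \<in> clifford_span r s S"
  using assms unfolding clifford_span_def by blast

lemma clifford_span_mono:
  assumes "A \<subseteq> S" "x \<in> clifford_span r s A"
  shows "x \<in> clifford_span r s S"
  using assms unfolding clifford_span_def by blast

lemma clifford_span_base:
  assumes "S \<subseteq> carrier C" "x \<in> S"
  shows "x \<in> clifford_span r s S"
proof (rule clifford_spanI)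
  show "x = finsum C (\<lambda>y. clifford_smult r s 1 y) {x}"
    using assms by (auto simp: smult_one clifford.finsum_insert)
qed (use assms in auto)

text \<open>Padding with zero coefficients brings two combinations over different finite sets to a
  common index set, where the coefficients can be added.\<close>

lemma clifford_span_extend:
  assumes "S \<subseteq> carrier C" "finite B" "B \<subseteq> S" "A \<subseteq> B"
  shows "finsum C (\<lambda>x. clifford_smult r s (a x) x) A =
    finsum C (\<lambda>x. clifford_smult r s (if x \<in> A then a x else 0) x) B"
proof (rule clifford.add.finprod_mono_neutral_cong_left)
qed (use assms in \<open>auto simp: smult_zero_left\<close>)

lemma clifford_span_add:
  assumes S: "S \<subseteq> carrier C" and x: "x \<in> clifford_span r s S" and y: "y \<in> clifford_span r s S"
  shows "x \<oplus>\<^bsub>C\<^esub> y \<in> clifford_span r s S"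
proof -
  obtain a A where A: "x = finsum C (\<lambda>x. clifford_smult r s (a x) x) A" "finite A" "A \<subseteq> S"
    using x unfolding clifford_span_def by blast
  obtain b B where B: "y = finsum C (\<lambda>x. clifford_smult r s (b x) x) B" "finite B" "B \<subseteq> S"
    using y unfolding clifford_span_def by blast
  let ?a = "\<lambda>x. if x \<in> A then a x else 0" and ?b = "\<lambda>x. if x \<in> B then b x else 0"
  have AB: "finite (A \<union> B)" "A \<union> B \<subseteq> S" using A B by auto
  have "x \<oplus>\<^bsub>C\<^esub> y = finsum C (\<lambda>x. clifford_smult r s (?a x) x) (A \<union> B) \<oplus>\<^bsub>C\<^esub>
      finsum C (\<lambda>x. clifford_smult r s (?b x) x) (A \<union> B)"
    unfolding A(1) B(1) clifford_span_extend[OF S AB Un_upper1] clifford_span_extend[OF S AB Un_upper2] ..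
  also have "\<dots> = finsum C (\<lambda>x. clifford_smult r s (?a x) x \<oplus>\<^bsub>C\<^esub> clifford_smult r s (?b x) x) (A \<union> B)"
    by (rule clifford.finsum_addf[symmetric]) (use S AB in auto)
  also have "\<dots> = finsum C (\<lambda>x. clifford_smult r s (?a x + ?b x) x) (A \<union> B)"
    by (rule clifford.finsum_cong') (use S AB in \<open>auto simp only: smult_add_left smult_closed\<close>)
  finally show ?thesis
    by (rule clifford_spanI[OF AB])
qed

lemma clifford_span_zero: "\<zero>\<^bsub>C\<^esub> \<in> clifford_span r s S"
  by (rule clifford_spanI[of "{}"]) simp_all

lemma clifford_span_induct [consumes 2, case_names zero base add smult]:
  assumes S: "S \<subseteq> carrier C" and x: "x \<in> clifford_span r s S"
    and zero: "P \<zero>\<^bsub>C\<^esub>"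
    and base: "\<And>y. y \<in> S \<Longrightarrow> P y"
    and add: "\<And>y z. y \<in> carrier C \<Longrightarrow> z \<in> carrier C \<Longrightarrow> P y \<Longrightarrow> P z \<Longrightarrow> P (y \<oplus>\<^bsub>C\<^esub> z)"
    and smult: "\<And>a y. y \<in> carrier C \<Longrightarrow> P y \<Longrightarrow> P (clifford_smult r s a y)"
  shows "P x"
proof -
  obtain a A where A: "x = finsum C (\<lambda>x. clifford_smult r s (a x) x) A" "finite A" "A \<subseteq> S"
    using x unfolding clifford_span_def by blast
  have "P (finsum C (\<lambda>x. clifford_smult r s (a x) x) A)"
    using A(2,3)
  proof (induction A rule: finite_induct)
    case empty
    then show ?case by (simp add: zero)
  next
    case (insert y A)
    have "(\<lambda>x. clifford_smult r s (a x) x) \<in> A \<rightarrow> carrier C" "y \<in> carrier C"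
      using insert.prems S by auto
    then show ?case
      using insert by (simp add: clifford.finsum_insert add base smult)
  qed
  then show ?thesis by (simp add: A(1))
qed

lemma clifford_span_closed:
  assumes "S \<subseteq> carrier C" "x \<in> clifford_span r s S"
  shows "x \<in> carrier C"
  using assms by (induction rule: clifford_span_induct) (use assms in auto)

lemma clifford_span_smult:
  assumes S: "S \<subseteq> carrier C" and x: "x \<in> clifford_span r s S"
  shows "clifford_smult r s a x \<in> clifford_span r s S"
proof -
  have "clifford_smult r s a x \<in> clifford_span r s S \<and> x \<in> clifford_span r s S" for a
    using assms
  \<comment> \<open>The scalar must vary: in the last case a(b y) is read as (ab) y, and the
    induction hypothesis is applied to the scalar ab.\<close>
  proof (induction arbitrary: a rule: clifford_span_induct)
    case zero
    then show ?case by (simp add: smult_zero_right clifford_span_zero)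
  next
    case (base y)
    then have y: "y \<in> carrier C" using S by blast
    then have "clifford_smult r s a y \<in> clifford_span r s S"
      using base by (intro clifford_spanI[of "{y}" _ _ "\<lambda>_. a"]) auto
    then show ?case using clifford_span_base[OF S base] by simp
  next
    case (add y z)
    then show ?case by (auto simp: smult_add_right intro!: clifford_span_add[OF S])
  next
    case (smult b y)
    then show ?case by (simp add: smult_smult)
  qed
  then show ?thesis by blast
qed

lemma clifford_span_minus:
  assumes S: "S \<subseteq> carrier C" and x: "x \<in> clifford_span r s S"
  shows "\<ominus>\<^bsub>C\<^esub> x \<in> clifford_span r s S"
proof -
  have x': "x \<in> carrier C" using clifford_span_closed[OF assms] .
  have "x \<oplus>\<^bsub>C\<^esub> clifford_smult r s (- 1) x = \<zero>\<^bsub>C\<^esub>"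
    using smult_add_left[OF x', of 1 "- 1"] x' by (simp add: smult_one smult_zero_left)
  then have "\<ominus>\<^bsub>C\<^esub> x = clifford_smult r s (- 1) x"
    using x' by (metis clifford.add.inv_comm clifford.minus_equality smult_closed)
  then show ?thesis using clifford_span_smult[OF assms] by simp
qed

lemma clifford_span_finite:
  assumes "x \<in> clifford_span r s S"
  obtains A where "finite A" "A \<subseteq> S" "x \<in> clifford_span r s A"
  using assms unfolding clifford_span_def by blast


subsection \<open>Fixed vectors of diagonal sign maps\<close>

lemma linear_endo_zero:
  assumes "linear_endo T"
  shows "T \<zero>\<^bsub>C\<^esub> = \<zero>\<^bsub>C\<^esub>"
proof -
  have "T (clifford_smult r s 0 \<zero>\<^bsub>C\<^esub>) = clifford_smult r s 0 (T \<zero>\<^bsub>C\<^esub>)" "T \<zero>\<^bsub>C\<^esub> \<in> carrier C"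
    using assms by (auto simp: linear_endo_def clifford_linear_def)
  then show ?thesis by (simp add: smult_zero_left smult_zero_right)
qed

lemma fixed_in_span:
  assumes char: "CHAR('f::field) \<noteq> 2"
    and A: "(A :: 'f clifford set) \<subseteq> carrier C" and x: "x \<in> clifford_span r s A"
    and "sign_diagonal A T" and fixed: "T x = x"
  shows "x \<in> clifford_span r s {y \<in> A. T y = y}"
proof -
  have T: "linear_endo T" "\<And>y. y \<in> A \<Longrightarrow> upto_sign (T y) y"
    using assms(4) by (auto simp: sign_diagonal_def)
  let ?B = "{y \<in> A. T y = y}"
  have B: "?B \<subseteq> carrier C" using A by blast
  have xC: "x \<in> carrier C" using clifford_span_closed[OF A x] .
  \<comment> \<open>Being fixed by \<open>T\<close> is not inherited by the summands of
    \<open>x\<close>, so the induction runs over the expression x + T x, which is linear in x. It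
    becomes 2x only at the end.\<close>
  have "x \<oplus>\<^bsub>C\<^esub> T x \<in> clifford_span r s ?B"
    using A x
  proof (induction rule: clifford_span_induct)
    case zero
    show ?case by (simp add: linear_endo_zero[OF T(1)] clifford_span_zero)
  next
    case (base y)
    then have y: "y \<in> carrier C" using A by blast
    show ?case
    proof (cases "T y = y")
      case True
      then have "y \<in> clifford_span r s ?B" using base by (intro clifford_span_base[OF B]) simp
      then show ?thesis using True clifford_span_add[OF B] by simp
    next
      case False
      \<comment> \<open>Here y + T y = 0, so \<open>y\<close> contributes nothing.\<close>
      then have "T y = \<ominus>\<^bsub>C\<^esub> y" using T(2)[OF base] by (simp add: upto_sign_def)
      then show ?thesis using y by (simp add: clifford.r_neg clifford_span_zero)
    qed
  next
    case (add y z)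
    then have m: "T y \<in> carrier C" "T z \<in> carrier C" "T (y \<oplus>\<^bsub>C\<^esub> z) = T y \<oplus>\<^bsub>C\<^esub> T z"
      using T(1) by (auto simp: linear_endo_def)
    then have "(y \<oplus>\<^bsub>C\<^esub> z) \<oplus>\<^bsub>C\<^esub> T (y \<oplus>\<^bsub>C\<^esub> z) = (y \<oplus>\<^bsub>C\<^esub> T y) \<oplus>\<^bsub>C\<^esub> (z \<oplus>\<^bsub>C\<^esub> T z)"
      using add by (simp add: clifford.a_ac)
    then show ?case using add clifford_span_add[OF B] by simp
  next
    case (smult a y)
    then have "T y \<in> carrier C" "T (clifford_smult r s a y) = clifford_smult r s a (T y)"
      using T(1) by (auto simp: linear_endo_def clifford_linear_def)
    then show ?case using smult clifford_span_smult[OF B] by (simp flip: smult_add_right)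
  qed
  then have "clifford_smult r s (1 / 2) (x \<oplus>\<^bsub>C\<^esub> x) \<in> clifford_span r s ?B"
    unfolding fixed by (rule clifford_span_smult[OF B])
  then show ?thesis by (simp only: half_double[OF char xC])
qed

text \<open>A single minimal set serves all maps \<open>T\<close> simultaneously.\<close>

lemma minimal_support:
  assumes char: "CHAR('f::field) \<noteq> 2"
    and S: "(S :: 'f clifford set) \<subseteq> carrier C" and x: "x \<in> clifford_span r s S"
  obtains A where "A \<subseteq> S" "x \<in> clifford_span r s A"
    "\<forall>T. sign_diagonal S T \<longrightarrow> T x = x \<longrightarrow> (\<forall>y\<in>A. T y = y)"
proof -
  let ?P = "\<lambda>A. finite A \<and> A \<subseteq> S \<and> x \<in> clifford_span r s A"
  obtain A0 where "finite A0" "A0 \<subseteq> S" "x \<in> clifford_span r s A0"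
    using clifford_span_finite[OF x] .
  then have "\<exists>A. ?P A \<and> (\<forall>B. ?P B \<longrightarrow> card A \<le> card B)"
    by (intro ex_has_least_nat[of ?P A0 card]) simp
  then obtain A where A: "finite A" "A \<subseteq> S" "x \<in> clifford_span r s A"
    and min: "\<And>B. finite B \<Longrightarrow> B \<subseteq> S \<Longrightarrow> x \<in> clifford_span r s B \<Longrightarrow> card A \<le> card B"
    by auto
  show thesis
  proof (rule that[of A])
    show "A \<subseteq> S" "x \<in> clifford_span r s A" by (fact A)+
    show "\<forall>T. sign_diagonal S T \<longrightarrow> T x = x \<longrightarrow> (\<forall>y\<in>A. T y = y)"
    proof (intro allI impI ballI)
      fix T y
      assume T: "sign_diagonal S T" "T x = x" and y: "y \<in> A"
      have "sign_diagonal A T" using T(1) A(2) by (auto simp: sign_diagonal_def)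
      then have "x \<in> clifford_span r s {y \<in> A. T y = y}"
        using A(2) S by (intro fixed_in_span[where T = T, OF char _ A(3)] T(2)) auto
      \<comment> \<open>The \<open>T\<close>-fixed part of \<open>A\<close> still spans
        \<open>x\<close>; as \<open>A\<close> has least cardinality, this part cannot be smaller and
        so is all of \<open>A\<close>.\<close>
      then have "card A \<le> card {y \<in> A. T y = y}"
        by (rule min[rotated 2]) (use A in auto)
      then have "{y \<in> A. T y = y} = A" by (intro card_seteq A(1)) auto
      then show "T y = y" using y by blast
    qed
  qed
qed


subsection \<open>Monomials in the generators\<close>

lemma upto_sign_refl [simp]: "x \<in> carrier C \<Longrightarrow> upto_sign x x"
  by (simp add: upto_sign_def)

lemma upto_sign_trans [trans]:
  "upto_sign x y \<Longrightarrow> upto_sign y z \<Longrightarrow> upto_sign x z"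
  by (auto simp: upto_sign_def)

lemma upto_sign_uminus: "upto_sign x y \<Longrightarrow> upto_sign (\<ominus>\<^bsub>C\<^esub> x) y"
  by (auto simp: upto_sign_def)

lemma upto_sign_mult_left:
  assumes "upto_sign x y" "z \<in> carrier C"
  shows "upto_sign (z \<otimes>\<^bsub>C\<^esub> x) (z \<otimes>\<^bsub>C\<^esub> y)"
  using assms by (auto simp: upto_sign_def clifford.r_minus)

lemma upto_sign_mult_right:
  assumes "upto_sign x y" "z \<in> carrier C"
  shows "upto_sign (x \<otimes>\<^bsub>C\<^esub> z) (y \<otimes>\<^bsub>C\<^esub> z)"
  using assms by (auto simp: upto_sign_def clifford.l_minus)

section \<open>The Clifford relations between the generators\<close>

lemma gen_closed [simp, intro]: "clifford_gen r s i \<in> carrier C"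
  unfolding clifford_gen_def clifford_vec_def using tensor_vec_closed clifford_carrier by blast

lemma basis_simps:
  "clifford_basis r s [] = \<one>\<^bsub>C\<^esub>"
  "clifford_basis r s (i # w) = clifford_gen r s i \<otimes>\<^bsub>C\<^esub> clifford_basis r s w"
  by (simp_all add: clifford_basis_def)

lemma basis_closed [simp, intro]: "clifford_basis r s w \<in> carrier C"
  by (induction w) (auto simp: basis_simps)

text \<open>This is the relator attached to \<open>v\<close>, read in the quotient with the scalar
  moved to the other side.\<close>

lemma vec_square:
  "clifford_vec r s v \<otimes>\<^bsub>C\<^esub> clifford_vec r s v = clifford_proj r s (tensor_scalar (- Q_form r s v v))"
proof -
  have "tensor_vec (r + s) v * tensor_vec (r + s) v - tensor_scalar (- Q_form r s v v) \<in> clifford_ideal r s"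
    using clifford_relator_in_ideal[of r s v] by (simp add: tensor_scalar_def single_uminus)
  then show ?thesis
    unfolding clifford_vec_def
    by (simp add: clifford_proj_mult clifford_proj_eq_iff tensor_vec_closed tensor_mult_closed
        tensor_scalar_closed)
qed

lemma scalar_minus_one: "clifford_proj r s (tensor_scalar (- 1)) = \<ominus>\<^bsub>C\<^esub> \<one>\<^bsub>C\<^esub>"
proof -
  have "tensor_scalar (- 1) = - tensor_scalar (1 :: 'a)"
    by (simp add: tensor_scalar_def single_uminus)
  then show ?thesis
    by (simp add: tensor_scalar_closed flip: clifford_proj_uminus scalar_one)
qed

lemma tensor_vec_add: "tensor_vec n (\<lambda>k. u k + v k) = tensor_vec n u + tensor_vec n v"
  by (simp add: tensor_vec_def single_add sum.distrib)

lemma Q_form_units: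
  assumes "i \<in> {1..r+s}"
  shows "Q_form r s (\<lambda>k. if k = i then 1 else 0) (\<lambda>k. if k = i then 1 else 0) =
    (if i \<le> r then 1 else - 1 :: 'f::field)"
  using assms by (auto simp: Q_form_def if_distrib cong: if_cong)

text \<open>By \<open>vec_square\<close> the square is -Q(e_i, e_i), hence -1 for i <= r and 1 for i
  > r. Later arguments only ask that it be a sign.\<close>

lemma gen_square:
  assumes "i \<in> {1..r+s}"
  shows "upto_sign (clifford_gen r s i \<otimes>\<^bsub>C\<^esub> clifford_gen r s i) \<one>\<^bsub>C\<^esub>"
  unfolding clifford_gen_def vec_square Q_form_units[OF assms]
  by (auto simp: upto_sign_def scalar_one scalar_minus_one)

text \<open>Polarization: the relations are given for squares only, so the square of e_i + e_j is
  computed twice, by expanding the product and by the relation for this vector. Orthogonality of e_i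
  and e_j makes the mixed terms cancel.\<close>

lemma gen_anticommute:
  assumes i: "i \<in> {1..r+s}" and j: "j \<in> {1..r+s}" and ij: "i \<noteq> j"
  shows "clifford_gen r s i \<otimes>\<^bsub>C\<^esub> clifford_gen r s j = \<ominus>\<^bsub>C\<^esub> (clifford_gen r s j \<otimes>\<^bsub>C\<^esub> clifford_gen r s i)"
proof -
  let ?u = "\<lambda>i k. if k = i then 1 else 0 :: 'a"
  let ?v = "\<lambda>k. ?u i k + ?u j k"
  let ?x = "clifford_gen r s i :: 'a clifford" and ?y = "clifford_gen r s j :: 'a clifford"
  have sum: "clifford_vec r s ?v = ?x \<oplus>\<^bsub>C\<^esub> ?y"
    by (simp only: clifford_gen_def clifford_vec_def clifford_proj_add tensor_vec_closed
        tensor_vec_add)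
  \<comment> \<open>For distinct \<open>i\<close> and \<open>j\<close>, at each coordinate
    \<open>k\<close> at most one of the two unit vectors is nonzero, so no mixed product
    survives.\<close>
  have "?v k * ?v k = ?u i k * ?u i k + ?u j k * ?u j k" for k
    using ij by auto
  then have Q: "Q_form r s ?v ?v = Q_form r s (?u i) (?u i) + Q_form r s (?u j) (?u j)"
    by (simp only: Q_form_def sum.distrib) simp
  have "?x \<otimes>\<^bsub>C\<^esub> ?x \<oplus>\<^bsub>C\<^esub> ?y \<otimes>\<^bsub>C\<^esub> ?y \<oplus>\<^bsub>C\<^esub> (?x \<otimes>\<^bsub>C\<^esub> ?y \<oplus>\<^bsub>C\<^esub> ?y \<otimes>\<^bsub>C\<^esub> ?x) = (?x \<oplus>\<^bsub>C\<^esub> ?y) \<otimes>\<^bsub>C\<^esub> (?x \<oplus>\<^bsub>C\<^esub> ?y)"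
    by (simp add: clifford.l_distr clifford.r_distr clifford.a_ac)
  also have "\<dots> = clifford_proj r s (tensor_scalar (- Q_form r s (?u i) (?u i)) + tensor_scalar (- Q_form r s (?u j) (?u j)))"
    unfolding sum[symmetric] vec_square Q by (simp add: tensor_scalar_def flip: single_add)
  also have "\<dots> = ?x \<otimes>\<^bsub>C\<^esub> ?x \<oplus>\<^bsub>C\<^esub> ?y \<otimes>\<^bsub>C\<^esub> ?y"
    by (simp only: clifford_gen_def vec_square clifford_proj_add tensor_scalar_closed)
  finally have "?x \<otimes>\<^bsub>C\<^esub> ?y \<oplus>\<^bsub>C\<^esub> ?y \<otimes>\<^bsub>C\<^esub> ?x = \<zero>\<^bsub>C\<^esub>"
    by (simp add: clifford.add.r_cancel_one')
  then show ?thesis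
    by (metis clifford.minus_equality clifford.m_closed gen_closed)
qed

section \<open>Commutation and squares of monomials up to sign\<close>

lemma gen_commute_sign:
  assumes "i \<in> {1..r+s}" "j \<in> {1..r+s}"
  shows "upto_sign (clifford_gen r s i \<otimes>\<^bsub>C\<^esub> clifford_gen r s j) (clifford_gen r s j \<otimes>\<^bsub>C\<^esub> clifford_gen r s i)"
  using gen_anticommute[OF assms] by (cases "i = j") (auto simp: upto_sign_def)

lemma gen_basis_commute_sign:
  assumes "i \<in> {1..r+s}" "set w \<subseteq> {1..r+s}"
  shows "upto_sign (clifford_gen r s i \<otimes>\<^bsub>C\<^esub> clifford_basis r s w) (clifford_basis r s w \<otimes>\<^bsub>C\<^esub> clifford_gen r s i :: 'f::field clifford)"
  using assms(2)
proof (induction w)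
  case (Cons j w)
  let ?x = "clifford_gen r s i :: 'f clifford" and ?y = "clifford_gen r s j :: 'f clifford" and ?z = "clifford_basis r s w :: 'f clifford"
  have "?x \<otimes>\<^bsub>C\<^esub> (?y \<otimes>\<^bsub>C\<^esub> ?z) = (?x \<otimes>\<^bsub>C\<^esub> ?y) \<otimes>\<^bsub>C\<^esub> ?z"
    by (simp add: clifford.m_assoc)
  also have "upto_sign \<dots> ((?y \<otimes>\<^bsub>C\<^esub> ?x) \<otimes>\<^bsub>C\<^esub> ?z)"
    using Cons.prems assms(1) by (intro upto_sign_mult_right gen_commute_sign) auto
  also have "(?y \<otimes>\<^bsub>C\<^esub> ?x) \<otimes>\<^bsub>C\<^esub> ?z = ?y \<otimes>\<^bsub>C\<^esub> (?x \<otimes>\<^bsub>C\<^esub> ?z)"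
    by (simp add: clifford.m_assoc)
  also have "upto_sign \<dots> (?y \<otimes>\<^bsub>C\<^esub> (?z \<otimes>\<^bsub>C\<^esub> ?x))"
    using Cons by (intro upto_sign_mult_left) auto
  also have "?y \<otimes>\<^bsub>C\<^esub> (?z \<otimes>\<^bsub>C\<^esub> ?x) = ?y \<otimes>\<^bsub>C\<^esub> ?z \<otimes>\<^bsub>C\<^esub> ?x"
    by (simp add: clifford.m_assoc)
  finally show ?case by (simp add: basis_simps)
qed (simp add: basis_simps)

text \<open>The letters of \<open>v\<close> are carried past \<open>w\<close> one at a time, each at
  the cost of a sign. This is what makes monomials eigenvectors of conjugation by a
  monomial.\<close>

lemma basis_commute_sign:
  assumes "set v \<subseteq> {1..r+s}" "set w \<subseteq> {1..r+s}"
  shows "upto_sign (clifford_basis r s v \<otimes>\<^bsub>C\<^esub> clifford_basis r s w) (clifford_basis r s w \<otimes>\<^bsub>C\<^esub> clifford_basis r s v :: 'f::field clifford)"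
  using assms(1)
proof (induction v)
  case (Cons j v)
  let ?x = "clifford_basis r s v :: 'f clifford" and ?y = "clifford_gen r s j :: 'f clifford" and ?z = "clifford_basis r s w :: 'f clifford"
  have "(?y \<otimes>\<^bsub>C\<^esub> ?x) \<otimes>\<^bsub>C\<^esub> ?z = ?y \<otimes>\<^bsub>C\<^esub> (?x \<otimes>\<^bsub>C\<^esub> ?z)"
    by (simp add: clifford.m_assoc)
  also have "upto_sign \<dots> (?y \<otimes>\<^bsub>C\<^esub> (?z \<otimes>\<^bsub>C\<^esub> ?x))"
    using Cons by (intro upto_sign_mult_left) auto
  also have "?y \<otimes>\<^bsub>C\<^esub> (?z \<otimes>\<^bsub>C\<^esub> ?x) = (?y \<otimes>\<^bsub>C\<^esub> ?z) \<otimes>\<^bsub>C\<^esub> ?x"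
    by (simp add: clifford.m_assoc)
  also have "upto_sign \<dots> ((?z \<otimes>\<^bsub>C\<^esub> ?y) \<otimes>\<^bsub>C\<^esub> ?x)"
    using Cons.prems assms(2) by (intro upto_sign_mult_right gen_basis_commute_sign) auto
  also have "(?z \<otimes>\<^bsub>C\<^esub> ?y) \<otimes>\<^bsub>C\<^esub> ?x = ?z \<otimes>\<^bsub>C\<^esub> (?y \<otimes>\<^bsub>C\<^esub> ?x)"
    by (simp add: clifford.m_assoc)
  finally show ?case by (simp add: basis_simps)
qed (simp add: basis_simps)

text \<open>Its purpose is invertibility: a monomial is its own inverse up to sign.\<close>

lemma basis_square:
  assumes "set w \<subseteq> {1..r+s}"
  shows "upto_sign (clifford_basis r s w \<otimes>\<^bsub>C\<^esub> clifford_basis r s w) (\<one>\<^bsub>C\<^esub> :: 'f::field clifford)"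
  using assms
proof (induction w)
  case (Cons j w)
  let ?y = "clifford_gen r s j :: 'f clifford" and ?z = "clifford_basis r s w :: 'f clifford"
  have "(?y \<otimes>\<^bsub>C\<^esub> ?z) \<otimes>\<^bsub>C\<^esub> (?y \<otimes>\<^bsub>C\<^esub> ?z) = ?y \<otimes>\<^bsub>C\<^esub> (?z \<otimes>\<^bsub>C\<^esub> (?y \<otimes>\<^bsub>C\<^esub> ?z))"
    by (simp add: clifford.m_assoc)
  \<comment> \<open>The second copy of e_j is carried to the right end, so that the two copies of
    the shorter monomial become adjacent and the induction hypothesis applies.\<close>
  also have "upto_sign \<dots> (?y \<otimes>\<^bsub>C\<^esub> (?z \<otimes>\<^bsub>C\<^esub> (?z \<otimes>\<^bsub>C\<^esub> ?y)))"
    using Cons.prems by (intro upto_sign_mult_left gen_basis_commute_sign) auto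
  also have "?y \<otimes>\<^bsub>C\<^esub> (?z \<otimes>\<^bsub>C\<^esub> (?z \<otimes>\<^bsub>C\<^esub> ?y)) = (?y \<otimes>\<^bsub>C\<^esub> (?z \<otimes>\<^bsub>C\<^esub> ?z)) \<otimes>\<^bsub>C\<^esub> ?y"
    by (simp add: clifford.m_assoc)
  also have "upto_sign \<dots> ((?y \<otimes>\<^bsub>C\<^esub> \<one>\<^bsub>C\<^esub>) \<otimes>\<^bsub>C\<^esub> ?y)"
    using Cons by (intro upto_sign_mult_right upto_sign_mult_left) auto
  also have "(?y \<otimes>\<^bsub>C\<^esub> \<one>\<^bsub>C\<^esub>) \<otimes>\<^bsub>C\<^esub> ?y = ?y \<otimes>\<^bsub>C\<^esub> ?y" by simp
  also have "upto_sign \<dots> \<one>\<^bsub>C\<^esub>" using Cons.prems by (intro gen_square) auto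
  finally show ?case by (simp add: basis_simps)
qed (simp add: basis_simps)

text \<open>One round of insertion sort. The new letter is moved past smaller letters with sign
  changes; if it meets an equal letter, the pair collapses to a sign.\<close>

lemma gen_basis_sorted:
  assumes "i \<in> {1..r+s}" "sorted_wrt (<) I" "set I \<subseteq> {1..r+s}"
  shows "\<exists>J. sorted_wrt (<) J \<and> set J \<subseteq> insert i (set I) \<and>
    upto_sign (clifford_gen r s i \<otimes>\<^bsub>C\<^esub> clifford_basis r s I) (clifford_basis r s J :: 'f::field clifford)"
  using assms(2,3)
proof (induction I)
  case Nil
  then show ?case by (intro exI[of _ "[i]"]) (simp add: basis_simps)
next
  case (Cons k I)
  let ?x = "clifford_gen r s i :: 'f clifford" and ?y = "clifford_gen r s k :: 'f clifford"
    and ?z = "clifford_basis r s I :: 'f clifford"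
  have k: "k \<in> {1..r+s}" using Cons.prems by simp
  consider "i < k" | "i = k" | "k < i" by linarith
  then show ?case
  proof cases
    case 1
    then show ?thesis using Cons.prems
      by (intro exI[of _ "i # k # I"]) (auto simp: basis_simps)
  next
    case 2
    have "?x \<otimes>\<^bsub>C\<^esub> (?x \<otimes>\<^bsub>C\<^esub> ?z) = (?x \<otimes>\<^bsub>C\<^esub> ?x) \<otimes>\<^bsub>C\<^esub> ?z" by (simp add: clifford.m_assoc)
    also have "upto_sign \<dots> (\<one>\<^bsub>C\<^esub> \<otimes>\<^bsub>C\<^esub> ?z)"
      using assms(1) by (intro upto_sign_mult_right gen_square) auto
    finally show ?thesis using Cons.prems 2 by (intro exI[of _ I]) (auto simp: basis_simps)
  next
    case 3
    obtain J where J: "sorted_wrt (<) J" "set J \<subseteq> insert i (set I)"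
      "upto_sign (?x \<otimes>\<^bsub>C\<^esub> ?z) (clifford_basis r s J)"
      using Cons by auto
    have "?x \<otimes>\<^bsub>C\<^esub> (?y \<otimes>\<^bsub>C\<^esub> ?z) = (?x \<otimes>\<^bsub>C\<^esub> ?y) \<otimes>\<^bsub>C\<^esub> ?z" by (simp add: clifford.m_assoc)
    also have "upto_sign \<dots> ((?y \<otimes>\<^bsub>C\<^esub> ?x) \<otimes>\<^bsub>C\<^esub> ?z)"
      using assms(1) k by (intro upto_sign_mult_right gen_commute_sign) auto
    also have "(?y \<otimes>\<^bsub>C\<^esub> ?x) \<otimes>\<^bsub>C\<^esub> ?z = ?y \<otimes>\<^bsub>C\<^esub> (?x \<otimes>\<^bsub>C\<^esub> ?z)" by (simp add: clifford.m_assoc)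
    also have "upto_sign \<dots> (?y \<otimes>\<^bsub>C\<^esub> clifford_basis r s J)"
      using J by (intro upto_sign_mult_left) auto
    \<comment> \<open>Every letter of \<open>J\<close> is \<open>i\<close> or a letter of
      \<open>I\<close>, hence larger than \<open>k\<close>, so prepending \<open>k\<close> keeps the
      list increasing. The bound on \<open>set J\<close> in the statement serves this step.\<close>
    finally show ?thesis using J 3 Cons.prems
      by (intro exI[of _ "k # J"]) (auto simp: basis_simps)
  qed
qed

lemma basis_sorted:
  assumes "set w \<subseteq> {1..r+s}"
  shows "\<exists>y\<in>monomials. upto_sign (clifford_basis r s w) (y :: 'f::field clifford)"
proof -
  have "\<exists>J. sorted_wrt (<) J \<and> set J \<subseteq> {1..r+s} \<and>
      upto_sign (clifford_basis r s w) (clifford_basis r s J :: 'f clifford)"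
    using assms
  proof (induction w)
    case Nil
    then show ?case by (intro exI[of _ "[]"]) simp
  next
    case (Cons i w)
    then obtain I where I: "sorted_wrt (<) I" "set I \<subseteq> {1..r+s}"
      "upto_sign (clifford_basis r s w) (clifford_basis r s I :: 'f clifford)" by auto
    have i: "i \<in> {1..r+s}" using Cons.prems by simp
    obtain J where J: "sorted_wrt (<) J" "set J \<subseteq> insert i (set I)"
      "upto_sign (clifford_gen r s i \<otimes>\<^bsub>C\<^esub> clifford_basis r s I) (clifford_basis r s J :: 'f clifford)"
      using gen_basis_sorted[OF i I(1,2)] by blast
    have "upto_sign (clifford_gen r s i \<otimes>\<^bsub>C\<^esub> clifford_basis r s w)
        (clifford_gen r s i \<otimes>\<^bsub>C\<^esub> clifford_basis r s I :: 'f clifford)"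
      using I by (intro upto_sign_mult_left) auto
    also note J(3)
    finally show ?case using J I i by (intro exI[of _ J]) (auto simp: basis_simps)
  qed
  then show ?thesis by (auto simp: monomials_def)
qed

lemma monomials_closed: "monomials \<subseteq> carrier C"
  by (auto simp: monomials_def)

lemma basis_proj:
  assumes "set w \<subseteq> {1..r+s}"
  shows "clifford_basis r s w = clifford_proj r s (Poly_Mapping.single w 1)"
  using assms
proof (induction w)
  case Nil
  then show ?case by (simp add: basis_simps clifford_proj_one tensor_one)
next
  case (Cons i w)
  then have "Poly_Mapping.single [i] (1::'a) \<in> carrier (tensor_algebra (r + s))"
    "Poly_Mapping.single w (1::'a) \<in> carrier (tensor_algebra (r + s))"
    by (auto simp: tensor_carrier_iff)
  then show ?case
    using Cons by (simp add: basis_simps clifford_gen_proj clifford_proj_mult tensor_single_mult)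
qed

text \<open>Classes of words span the quotient, and by \<open>basis_sorted\<close> each such class
  is a monomial up to sign; the sign is absorbed by the span.\<close>

lemma clifford_spanned_by_monomials:
  assumes "(x :: 'f::field clifford) \<in> carrier C"
  shows "x \<in> clifford_span r s monomials"
proof -
  obtain p where p: "p \<in> carrier (tensor_algebra (r + s))" "x = clifford_proj r s p"
    using assms clifford_carrier by blast
  have "clifford_proj r s p \<in> clifford_span r s monomials"
    using p(1)
  proof (induction p rule: tensor_induct)
    case zero
    then show ?case using clifford_span_zero by (simp add: clifford_proj_zero)
  next
    case (single w a)
    then have "Poly_Mapping.single w (1::'f) \<in> carrier (tensor_algebra (r + s))"
      by (auto simp: tensor_carrier_iff)
    then have "clifford_proj r s (Poly_Mapping.single w a) = clifford_smult r s a (clifford_basis r s w)"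
      using single by (simp add: basis_proj clifford_smult_proj tensor_scalar_def tensor_single_mult)
    moreover have "(clifford_basis r s w :: 'f clifford) \<in> clifford_span r s monomials"
    proof -
      obtain y :: "'f clifford" where y: "y \<in> monomials" "upto_sign (clifford_basis r s w) y"
        using basis_sorted[OF single] by blast
      have "y \<in> clifford_span r s monomials" by (rule clifford_span_base[OF monomials_closed y(1)])
      then show ?thesis
        using y(2) clifford_span_minus[OF monomials_closed] unfolding upto_sign_def by metis
    qed
    ultimately show ?case using clifford_span_smult[OF monomials_closed] by simp
  next
    case (add p q)
    then show ?case
      using clifford_span_add[OF monomials_closed] by (simp flip: clifford_proj_add)
  qed
  then show ?thesis by (simp add: p(2))
qed


subsection \<open>The maps \<open>c\<close>, \<open>\<beta>\<close> and conjugation by a monomial\<close>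

lemma c_closed: "(x :: 'f::field clifford) \<in> carrier C \<Longrightarrow> clifford_c r s x \<in> carrier C"
  and c_add: "(x :: 'f clifford) \<in> carrier C \<Longrightarrow> y \<in> carrier C \<Longrightarrow>
    clifford_c r s (x \<oplus>\<^bsub>C\<^esub> y) = clifford_c r s x \<oplus>\<^bsub>C\<^esub> clifford_c r s y"
  and c_mult: "(x :: 'f clifford) \<in> carrier C \<Longrightarrow> y \<in> carrier C \<Longrightarrow>
    clifford_c r s (x \<otimes>\<^bsub>C\<^esub> y) = clifford_c r s y \<otimes>\<^bsub>C\<^esub> clifford_c r s x"
  and c_one: "clifford_c r s \<one>\<^bsub>C\<^esub> = (\<one>\<^bsub>C\<^esub> :: 'f clifford)"
  and c_smult: "(x :: 'f clifford) \<in> carrier C \<Longrightarrow>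
    clifford_c r s (clifford_smult r s a x) = clifford_smult r s a (clifford_c r s x)"
  and c_gen: "clifford_c r s (clifford_gen r s i) = \<ominus>\<^bsub>C\<^esub> (clifford_gen r s i :: 'f clifford)"
  using clifford_c_props[of r s, where ?'f = 'f]
  by (simp_all add: Pi_iff clifford_antiautomorphism_def ring_iso_def ring_hom_def clifford_linear_def
      clifford_gen_def)

lemma beta_closed: "(x :: 'f::field clifford) \<in> carrier C \<Longrightarrow> clifford_beta r s x \<in> carrier C"
  and beta_add: "(x :: 'f clifford) \<in> carrier C \<Longrightarrow> y \<in> carrier C \<Longrightarrow>
    clifford_beta r s (x \<oplus>\<^bsub>C\<^esub> y) = clifford_beta r s x \<oplus>\<^bsub>C\<^esub> clifford_beta r s y"
  and beta_mult: "(x :: 'f clifford) \<in> carrier C \<Longrightarrow> y \<in> carrier C \<Longrightarrow>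
    clifford_beta r s (x \<otimes>\<^bsub>C\<^esub> y) = clifford_beta r s x \<otimes>\<^bsub>C\<^esub> clifford_beta r s y"
  and beta_one: "clifford_beta r s \<one>\<^bsub>C\<^esub> = (\<one>\<^bsub>C\<^esub> :: 'f clifford)"
  and beta_smult: "(x :: 'f clifford) \<in> carrier C \<Longrightarrow>
    clifford_beta r s (clifford_smult r s a x) = clifford_smult r s a (clifford_beta r s x)"
  using clifford_beta_props[of r s, where ?'f = 'f]
  by (simp_all add: Pi_iff clifford_automorphism_def ring_iso_def ring_hom_def clifford_linear_def)

lemma beta_gen:
  assumes "i \<in> {1..r+s}"
  shows "upto_sign (clifford_beta r s (clifford_gen r s i)) (clifford_gen r s i :: 'f::field clifford)"
proof (cases "i \<le> r")
  case True
  then show ?thesis using assms clifford_beta_props[of r s, where ?'f = 'f] by (simp add: upto_sign_def)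
next
  case False
  then have "i = r + (i - r)" "i - r \<in> {1..s}" using assms by auto
  then obtain j where "i = r + j" "j \<in> {1..s}" by blast
  then show ?thesis using clifford_beta_props[of r s, where ?'f = 'f] by (simp add: upto_sign_def)
qed

text \<open>As an anti-automorphism \<open>c\<close> reverses the order of the letters, besides
  changing their signs; restoring the order costs only further signs.\<close>

lemma c_basis:
  assumes "set w \<subseteq> {1..r+s}"
  shows "upto_sign (clifford_c r s (clifford_basis r s w)) (clifford_basis r s w :: 'f::field clifford)"
  using assms
proof (induction w)
  case (Cons i w)
  let ?x = "clifford_gen r s i :: 'f clifford" and ?z = "clifford_basis r s w :: 'f clifford"
  have "clifford_c r s (?x \<otimes>\<^bsub>C\<^esub> ?z) = clifford_c r s ?z \<otimes>\<^bsub>C\<^esub> \<ominus>\<^bsub>C\<^esub> ?x"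
    by (simp add: c_mult c_gen)
  also have "upto_sign \<dots> (?z \<otimes>\<^bsub>C\<^esub> \<ominus>\<^bsub>C\<^esub> ?x)"
    using Cons by (intro upto_sign_mult_right) auto
  also have "upto_sign \<dots> (?z \<otimes>\<^bsub>C\<^esub> ?x)"
    by (simp add: upto_sign_def clifford.r_minus)
  also have "upto_sign \<dots> (?x \<otimes>\<^bsub>C\<^esub> ?z)"
    using basis_commute_sign[of w "[i]", where ?'f = 'f] Cons.prems by (simp add: basis_simps)
  finally show ?case by (simp add: basis_simps)
qed (simp add: basis_simps c_one)

lemma beta_basis:
  assumes "set w \<subseteq> {1..r+s}"
  shows "upto_sign (clifford_beta r s (clifford_basis r s w)) (clifford_basis r s w :: 'f::field clifford)"
  using assms
proof (induction w)
  case (Cons i w)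
  let ?x = "clifford_gen r s i :: 'f clifford" and ?z = "clifford_basis r s w :: 'f clifford"
  have "upto_sign (clifford_beta r s ?x \<otimes>\<^bsub>C\<^esub> clifford_beta r s ?z) (?x \<otimes>\<^bsub>C\<^esub> clifford_beta r s ?z)"
    using Cons.prems by (intro upto_sign_mult_right beta_gen) (auto intro: beta_closed)
  also have "upto_sign \<dots> (?x \<otimes>\<^bsub>C\<^esub> ?z)"
    using Cons by (intro upto_sign_mult_left) auto
  finally show ?case by (simp add: basis_simps beta_mult)
qed (simp add: basis_simps beta_one)

text \<open>The sign turns the condition c(x) = -x defining \<open>G_alg\<close> into a fixed-point
  condition, the form that \<open>minimal_support\<close> handles.\<close>

lemma linear_endo_minus_c: "linear_endo (\<lambda>x. \<ominus>\<^bsub>C\<^esub> clifford_c r s x)"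
  by (auto simp: linear_endo_def clifford_linear_def c_closed c_add c_smult smult_minus_right
      clifford.minus_add)

lemma linear_endo_beta: "linear_endo (clifford_beta r s)"
  by (auto simp: linear_endo_def clifford_linear_def beta_closed beta_add beta_smult)

lemma sign_diagonal_minus_c: "sign_diagonal monomials (\<lambda>x. \<ominus>\<^bsub>C\<^esub> clifford_c r s x)"
  using c_basis upto_sign_uminus linear_endo_minus_c by (auto simp: sign_diagonal_def monomials_def)

lemma sign_diagonal_beta: "sign_diagonal monomials (clifford_beta r s)"
  using beta_basis linear_endo_beta by (auto simp: sign_diagonal_def monomials_def)

section \<open>Conjugation by a monomial\<close>

lemma linear_endo_conj:
  assumes "u \<in> carrier C" "v \<in> carrier C"
  shows "linear_endo (\<lambda>x. u \<otimes>\<^bsub>C\<^esub> x \<otimes>\<^bsub>C\<^esub> v)"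
  using assms by (auto simp: linear_endo_def clifford_linear_def smult_mult_left smult_mult_right
      clifford.l_distr clifford.r_distr)

text \<open>The square of e_I is 1 or -1, so e_I or -e_I is a two-sided inverse.\<close>

lemma basis_inverse:
  assumes "set w \<subseteq> {1..r+s}"
  obtains v :: "'f::field clifford" where "v \<in> carrier C" "clifford_basis r s w \<otimes>\<^bsub>C\<^esub> v = \<one>\<^bsub>C\<^esub>" "v \<otimes>\<^bsub>C\<^esub> clifford_basis r s w = \<one>\<^bsub>C\<^esub>"
proof -
  let ?e = "clifford_basis r s w :: 'f clifford"
  consider "?e \<otimes>\<^bsub>C\<^esub> ?e = \<one>\<^bsub>C\<^esub>" | "?e \<otimes>\<^bsub>C\<^esub> ?e = \<ominus>\<^bsub>C\<^esub> \<one>\<^bsub>C\<^esub>"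
    using basis_square[OF assms] by (auto simp: upto_sign_def)
  then show thesis
  proof cases
    case 1
    then show thesis using that[of ?e] by simp
  next
    case 2
    then show thesis using that[of "\<ominus>\<^bsub>C\<^esub> ?e"] by (simp add: clifford.l_minus clifford.r_minus)
  qed
qed

text \<open>Commuting with an invertible element thereby becomes a fixed-point condition for a
  linear map, to be treated like those for -c and beta.\<close>

lemma commute_iff_conj:
  assumes "e \<in> carrier C" "v \<in> carrier C" "x \<in> carrier C"
    and "e \<otimes>\<^bsub>C\<^esub> v = \<one>\<^bsub>C\<^esub>" "v \<otimes>\<^bsub>C\<^esub> e = \<one>\<^bsub>C\<^esub>"
  shows "e \<otimes>\<^bsub>C\<^esub> x \<otimes>\<^bsub>C\<^esub> v = x \<longleftrightarrow> e \<otimes>\<^bsub>C\<^esub> x = x \<otimes>\<^bsub>C\<^esub> e"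
proof
  assume "e \<otimes>\<^bsub>C\<^esub> x \<otimes>\<^bsub>C\<^esub> v = x"
  then have "x \<otimes>\<^bsub>C\<^esub> e = e \<otimes>\<^bsub>C\<^esub> x \<otimes>\<^bsub>C\<^esub> v \<otimes>\<^bsub>C\<^esub> e" by simp
  then show "e \<otimes>\<^bsub>C\<^esub> x = x \<otimes>\<^bsub>C\<^esub> e" using assms by (simp add: clifford.m_assoc)
next
  assume "e \<otimes>\<^bsub>C\<^esub> x = x \<otimes>\<^bsub>C\<^esub> e"
  then show "e \<otimes>\<^bsub>C\<^esub> x \<otimes>\<^bsub>C\<^esub> v = x" using assms by (simp add: clifford.m_assoc)
qed

lemma conj_sign:
  assumes "e \<in> carrier C" "v \<in> carrier C" "x \<in> carrier C" "e \<otimes>\<^bsub>C\<^esub> v = \<one>\<^bsub>C\<^esub>"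
    and "upto_sign (e \<otimes>\<^bsub>C\<^esub> x) (x \<otimes>\<^bsub>C\<^esub> e)"
  shows "upto_sign (e \<otimes>\<^bsub>C\<^esub> x \<otimes>\<^bsub>C\<^esub> v) x"
proof -
  have "upto_sign (e \<otimes>\<^bsub>C\<^esub> x \<otimes>\<^bsub>C\<^esub> v) (x \<otimes>\<^bsub>C\<^esub> e \<otimes>\<^bsub>C\<^esub> v)"
    using assms by (intro upto_sign_mult_right)
  also have "x \<otimes>\<^bsub>C\<^esub> e \<otimes>\<^bsub>C\<^esub> v = x"
    using assms(1-4) by (simp add: clifford.m_assoc)
  finally show ?thesis .
qed


subsection \<open>The algebra \<open>\<KK>\<close> and its center\<close>

text \<open>This presents K as the common fixed space of the two sign-diagonal maps -c and
  beta.\<close>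

lemma K_alg_iff:
  "x \<in> K_alg r s \<longleftrightarrow> x \<in> carrier C \<and> \<ominus>\<^bsub>C\<^esub> clifford_c r s x = x \<and> clifford_beta r s x = x"
proof -
  have "clifford_c r s x = \<ominus>\<^bsub>C\<^esub> x \<longleftrightarrow> \<ominus>\<^bsub>C\<^esub> clifford_c r s x = x" if "x \<in> carrier C"
    using that c_closed[OF that] by (metis clifford.minus_minus)
  then show ?thesis by (auto simp: K_alg_def G_alg_def)
qed

lemma Z_K_iff:
  "(x :: 'f::field clifford) \<in> Z_K r s \<longleftrightarrow> x \<in> K_alg r s \<and> (\<forall>y\<in>K_alg r s. y \<otimes>\<^bsub>C\<^esub> x = x \<otimes>\<^bsub>C\<^esub> y)"
  proof -
  have "a \<ominus>\<^bsub>C\<^esub> b = \<zero>\<^bsub>C\<^esub> \<longleftrightarrow> b = a" if "a \<in> carrier C" "b \<in> carrier C" for a b :: "'f clifford"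
    using that unfolding clifford.minus_eq
    by (metis clifford.minus_equality clifford.minus_minus clifford.a_inv_closed clifford.r_neg)
  moreover have "K_alg r s \<subseteq> (carrier C :: 'f clifford set)" by (auto simp: K_alg_iff)
  ultimately show ?thesis
    unfolding Z_K_def lie_center_def lie_bracket_def by (simp add: subset_iff cong: conj_cong ball_cong)
qed

text \<open>Applying \<open>minimal_support\<close> to -c and beta places \<open>A\<close> inside K.
  The clause about all \<open>T\<close> is passed on, since for a central \<open>x\<close> the same
  \<open>A\<close> is tested against conjugations.\<close>

lemma K_alg_fixed_monomials:
  assumes "CHAR('f::field) \<noteq> 2" "(x :: 'f clifford) \<in> K_alg r s"
  obtains A where "A \<subseteq> monomials \<inter> K_alg r s" "x \<in> clifford_span r s A"
    "\<forall>T. sign_diagonal monomials T \<longrightarrow> T x = x \<longrightarrow> (\<forall>y\<in>A. T y = y)"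
proof -
  have x: "x \<in> clifford_span r s monomials" "\<ominus>\<^bsub>C\<^esub> clifford_c r s x = x" "clifford_beta r s x = x"
    using assms(2) clifford_spanned_by_monomials by (auto simp: K_alg_iff)
  obtain A where A: "A \<subseteq> monomials" "x \<in> clifford_span r s A"
    "\<forall>T. sign_diagonal monomials T \<longrightarrow> T x = x \<longrightarrow> (\<forall>y\<in>A. T y = y)"
    using minimal_support[OF assms(1) monomials_closed x(1)] .
  have c: "\<forall>y\<in>A. \<ominus>\<^bsub>C\<^esub> clifford_c r s y = y"
    using spec[OF A(3)] sign_diagonal_minus_c x(2) by blast
  have beta: "\<forall>y\<in>A. clifford_beta r s y = y"
    using spec[OF A(3)] sign_diagonal_beta x(3) by blast
  have "A \<subseteq> monomials \<inter> K_alg r s"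
    using A(1) monomials_closed c beta by (auto simp: K_alg_iff)
  then show thesis by (rule that[OF _ A(2,3)])
qed

text \<open>The easy inclusion: all conditions defining the center are linear.\<close>

lemma Z_K_span_closed:
  assumes "S \<subseteq> Z_K r s" "x \<in> clifford_span r s S"
  shows "x \<in> Z_K r s"
proof -
  have "S \<subseteq> carrier C" using assms(1) by (auto simp: Z_K_iff K_alg_iff)
  then show ?thesis using assms(2)
  proof (induction rule: clifford_span_induct)
    case zero
    show ?case
      using linear_endo_zero[OF linear_endo_minus_c] linear_endo_zero[OF linear_endo_beta]
      by (auto simp: Z_K_iff K_alg_iff)
  next
    case (base y)
    then show ?case using assms(1) by blast
  next
    case (add y z)
    then have "\<ominus>\<^bsub>C\<^esub> clifford_c r s (y \<oplus>\<^bsub>C\<^esub> z) = y \<oplus>\<^bsub>C\<^esub> z"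
      using linear_endo_minus_c by (auto simp: linear_endo_def Z_K_iff K_alg_iff)
    with add show ?case
      by (auto simp: Z_K_iff K_alg_iff beta_add clifford.l_distr clifford.r_distr)
  next
    case (smult a y)
    then have "\<ominus>\<^bsub>C\<^esub> clifford_c r s (clifford_smult r s a y) = clifford_smult r s a y"
      using linear_endo_minus_c by (auto simp: linear_endo_def clifford_linear_def Z_K_iff K_alg_iff)
    with smult show ?case
      by (auto simp: Z_K_iff K_alg_iff beta_smult smult_mult_left smult_mult_right)
  qed
qed

lemma Z_K_monomials:
  assumes char: "CHAR('f::field) \<noteq> 2" and x: "(x :: 'f clifford) \<in> Z_K r s"
  obtains A where "A \<subseteq> monomials \<inter> Z_K r s" "x \<in> clifford_span r s A"
proof -
  have xK: "x \<in> K_alg r s" "x \<in> carrier C" using x by (auto simp: Z_K_iff K_alg_iff)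
  obtain A where A: "A \<subseteq> monomials \<inter> K_alg r s" "x \<in> clifford_span r s A"
    "\<forall>T. sign_diagonal monomials T \<longrightarrow> T x = x \<longrightarrow> (\<forall>y\<in>A. T y = y)"
    using K_alg_fixed_monomials[OF char xK(1)] .
  \<comment> \<open>First, commutation of the terms of \<open>x\<close> with the monomials of K
    only; these are the elements for which conjugation is available as a sign-diagonal map.\<close>
  have comm: "e \<otimes>\<^bsub>C\<^esub> y = y \<otimes>\<^bsub>C\<^esub> e" if y: "y \<in> A" and e: "e \<in> monomials" "e \<in> K_alg r s" for y e
  proof -
    obtain J where J: "set J \<subseteq> {1..r+s}" "e = clifford_basis r s J"
      using e(1) by (auto simp: monomials_def)
    obtain v where v: "v \<in> carrier C" "e \<otimes>\<^bsub>C\<^esub> v = \<one>\<^bsub>C\<^esub>" "v \<otimes>\<^bsub>C\<^esub> e = \<one>\<^bsub>C\<^esub>"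
      using basis_inverse[OF J(1)] J(2) by metis
    have eC: "e \<in> carrier C" and yC: "y \<in> carrier C" using e A y by (auto simp: K_alg_iff)
    have "e \<otimes>\<^bsub>C\<^esub> y \<otimes>\<^bsub>C\<^esub> v = y"
    proof -
      have "upto_sign (e \<otimes>\<^bsub>C\<^esub> z \<otimes>\<^bsub>C\<^esub> v) z" if "z \<in> monomials" for z
      proof (rule conj_sign[OF eC v(1) _ v(2)])
        show "z \<in> carrier C" using that monomials_closed by blast
        show "upto_sign (e \<otimes>\<^bsub>C\<^esub> z) (z \<otimes>\<^bsub>C\<^esub> e)"
          using that J basis_commute_sign by (auto simp: monomials_def)
      qed
      then have "sign_diagonal monomials (\<lambda>x. e \<otimes>\<^bsub>C\<^esub> x \<otimes>\<^bsub>C\<^esub> v)"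
        by (simp add: sign_diagonal_def linear_endo_conj[OF eC v(1)])
      \<comment> \<open>Centrality of \<open>x\<close> is used here: \<open>e\<close> lies in K, so
        conjugation by \<open>e\<close> fixes \<open>x\<close>, and by the choice of
        \<open>A\<close> it then fixes each \<open>y\<close> in \<open>A\<close>.\<close>
      moreover have "e \<otimes>\<^bsub>C\<^esub> x \<otimes>\<^bsub>C\<^esub> v = x"
        using x e(2) unfolding commute_iff_conj[OF eC v(1) xK(2) v(2,3)] Z_K_iff by blast
      ultimately show ?thesis using spec[OF A(3), of "\<lambda>x. e \<otimes>\<^bsub>C\<^esub> x \<otimes>\<^bsub>C\<^esub> v"] y by blast
    qed
    then show ?thesis by (simp add: commute_iff_conj[OF eC v(1) yC v(2,3)])
  qed
  have "y \<in> Z_K r s" if y: "y \<in> A" for y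
    unfolding Z_K_iff
  proof (intro conjI ballI)
    show "y \<in> K_alg r s" using y A by blast
    then have yC: "y \<in> carrier C" by (simp add: K_alg_iff)
    \<comment> \<open>A general element of K is a combination of monomials that lie in K, so
      commutation extends to it by linearity.\<close>
    fix k :: "'f clifford" assume "k \<in> K_alg r s"
    then obtain B where B: "B \<subseteq> monomials \<inter> K_alg r s" "k \<in> clifford_span r s B"
      by (rule K_alg_fixed_monomials[OF char]) (rule that)
    have "B \<subseteq> carrier C" using B monomials_closed by blast
    then show "k \<otimes>\<^bsub>C\<^esub> y = y \<otimes>\<^bsub>C\<^esub> k"
      using B(2)
    proof (induction rule: clifford_span_induct)
      case (base e)
      then show ?case using comm[OF y] B by blast
    qed (use yC in \<open>auto simp: clifford.l_distr clifford.r_distr smult_mult_left smult_mult_right\<close>)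
  qed
  then show thesis using that[OF _ A(2)] A(1) by blast
qed

text \<open>The empty product is no multi-index; it is in \<open>\<KK>\<close> only if the algebra collapses.\<close>

lemma monomial_in_K_multi_index:
  assumes char: "CHAR('f::field) \<noteq> 2" and n: "r + s > 0"
    and y: "(y :: 'f clifford) \<in> monomials" "y \<in> K_alg r s"
  shows "\<exists>I. multi_index (r + s) I \<and> y = clifford_basis r s I"
proof (cases "y = \<one>\<^bsub>C\<^esub>")
  case True
  let ?one = "\<one>\<^bsub>C\<^esub> :: 'f clifford"
  \<comment> \<open>Since c(1) = 1, membership of 1 in K means 1 = -1. Halving 1 + 1 = 0 then gives
    1 = 0.\<close>
  have "\<ominus>\<^bsub>C\<^esub> ?one = ?one" using y(2) unfolding True K_alg_iff c_one by blast
  then have "?one \<oplus>\<^bsub>C\<^esub> ?one = ?one \<oplus>\<^bsub>C\<^esub> \<ominus>\<^bsub>C\<^esub> ?one" by (simp only:)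
  also have "\<dots> = \<zero>\<^bsub>C\<^esub>" by (simp add: clifford.r_neg)
  finally have "?one = clifford_smult r s (1 / 2) \<zero>\<^bsub>C\<^esub>"
    using half_double[OF char, of ?one] by (simp only: clifford.one_closed)
  then have one: "?one = \<zero>\<^bsub>C\<^esub>" by (simp only: smult_zero_right)
  have zero: "z = \<zero>\<^bsub>C\<^esub>" if "z \<in> carrier C" for z :: "'f clifford"
  proof -
    have "z = ?one \<otimes>\<^bsub>C\<^esub> z" using that by simp
    also have "\<dots> = \<zero>\<^bsub>C\<^esub>" unfolding one using that by simp
    finally show ?thesis .
  qed
  \<comment> \<open>In the zero ring all elements agree, so any multi-index would serve; [1] is one
    because r + s > 0.\<close>
  have "y = clifford_basis r s [1]"
    unfolding zero[OF basis_closed] by (rule zero) (use y(2) in \<open>simp add: K_alg_iff\<close>)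
  then show ?thesis using n by (intro exI[of _ "[1]"]) (auto simp: multi_index_def)
next
  case False
  obtain I where I: "sorted_wrt (<) I" "set I \<subseteq> {1..r+s}" "y = clifford_basis r s I"
    using y(1) unfolding monomials_def by blast
  moreover have "I \<noteq> []" using False I(3) basis_simps(1) by metis
  ultimately show ?thesis unfolding multi_index_def by blast
qed

end

section \<open>The center as a span of multi-indexed monomials\<close>

theorem proposition4p1:
  fixes r s :: nat
  assumes "CHAR('f::field) \<noteq> 2"
    and "s > 0"
  shows "(Z_K r s :: 'f clifford set) =
    clifford_span r s
      {clifford_basis r s I | I. multi_index (r + s) I \<and>
         (clifford_basis r s I :: 'f clifford) \<in> Z_K r s}"
    (is "_ = clifford_span r s ?S")
proof (intro equalityI subsetI)
  fix x :: "'f clifford" assume "x \<in> Z_K r s"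
  then obtain A where A: "A \<subseteq> monomials r s \<inter> Z_K r s" "x \<in> clifford_span r s A"
    by (rule Z_K_monomials[OF assms(1)]) (rule that)
  have "A \<subseteq> ?S"
  proof
    fix y assume "y \<in> A"
    then have y: "y \<in> monomials r s" "y \<in> Z_K r s" using A(1) by auto
    then have "y \<in> K_alg r s" by (simp only: Z_K_iff)
    \<comment> \<open>Positivity of \<open>s\<close> enters through r + s > 0, which guarantees that
      some multi-index exists.\<close>
    then obtain I where "multi_index (r + s) I" "y = clifford_basis r s I"
      using monomial_in_K_multi_index[OF assms(1) _ y(1)] assms(2) by auto
    then show "y \<in> ?S" using y(2) by blast
  qed
  then show "x \<in> clifford_span r s ?S"
    by (rule clifford_span_mono[OF _ A(2)])
next
  fix x :: "'f clifford" assume "x \<in> clifford_span r s ?S"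
  moreover have "?S \<subseteq> Z_K r s" by blast
  ultimately show "x \<in> Z_K r s" by (rule Z_K_span_closed[rotated])
qed

end
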